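(* Let $\mathbb{V}$ be a game mapping that satisfies the discrete dynamic programming principle on $\mathfrak{D}$, let $\mathcal{V}[\varrho]:=\mathbb{V}\big[c[\varrho]\big]$ for $\varrho\in\mathfrak{D}$, let $U_*:\Omega\to[0,1]$ be arbitrary, and suppose $z(n+s)=z(n)$ for all $z\in\mathbb{K}$, $n\in\mathbb{N}\cup\{0\}$, $s\in(0,1)$. Then each of the following conditions (c), (u), (e), (p), (q) is equivalent to the condition (u') $\lim_{n\to\infty,\,n\in\mathbb{N}}\sup_{\omega\in\Omega}\big|\mathcal{V}[\varpi_n](\omega)-U_*(\omega)\big|=0$. Conditions: (c) for every density $\mu\in\mathfrak{D}$ piecewise continuous on $(0,\infty)$, $\lim_{\lambda\to+0}\sup_{\omega}|\mathcal{V}[\mu^\lambda_{\mathrm{scale}}](\omega)-U_*(\omega)|=0$; (u) $\lim_{T\to+\infty}\sup_\omega|\mathcal{V}[\varpi_T](\omega)-U_*(\omega)|=0$; (e) $\lim_{\lambda\to+0}\sup_\omega|\mathcal{V}[\pi_\lambda](\omega)-U_*(\omega)|=0$; (p) for some power density $\varrho\in\mathfrak{D}$, $\lim_{T\to+\infty}\sup_\omega|\mathcal{V}[\varrho^T_{\mathrm{shift}}](\omega)-U_*(\omega)|=0$; (q) the same limit holds for every power density $\varrho\in\mathfrak{D}$.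
   Context: $\mathbb{R}_+=[0,\infty)$. Fix a nonempty set $\Omega$, a nonempty set $\mathbb{K}$ of maps $\mathbb{R}_+\to\Omega$, and $g:\Omega\to[0,1]$ with $t\mapsto g(z(t))$ Lebesgue measurable for each $z\in\mathbb{K}$. $\mathfrak{C}$: bounded maps $\mathbb{K}\to\mathbb{R}$; $\mathfrak{U}$: bounded maps $\Omega\to\mathbb{R}$. A game mapping is $\mathbb{V}:\mathfrak{C}\to\mathfrak{U}$ with $\mathbb{V}[Ac+B]=A\mathbb{V}[c]+B$ ($A\ge0$, $B\in\mathbb{R}$) and monotone ($c_1\le c_2$ pointwise on $\mathbb{K}$ implies $\mathbb{V}[c_1]\le\mathbb{V}[c_2]$ pointwise on $\Omega$). $\mathfrak{D}$: probability densities $\varrho:\mathbb{R}_+\to\mathbb{R}_+$. For $\varrho\in\mathfrak{D}$, $T>0$ with $\int_T^\infty\varrho>0$: $\varrho^T_{\mathrm{shift}}(t)=\varrho(t+T)/\int_T^\infty\varrho$; for $\lambda>0$: $\varrho^\lambda_{\mathrm{scale}}(t)=\lambda\varrho(\lambda t)$. $c[\varrho](z)=\int_0^\infty\varrho(t)g(z(t))dt$. For such $\varrho,T$: $d[\varrho,T](z)=\int_0^T\varrho(t)g(z(t))dt+\int_T^\infty\varrho\cdot\mathbb{V}[c[\varrho^T_{\mathrm{shift}}]](z(T))$. $\mathbb{V}$ satisfies the discrete dynamic programming principle on $\mathfrak{D}$ if $\mathbb{V}[d[\varrho,n]]=\mathbb{V}[c[\varrho]]$ for all $\varrho\in\mathfrak{D}$,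 $n\in\mathbb{N}$ with $\int_n^\infty\varrho>0$. $\varpi_T(t)=\frac1T1_{[0,T]}(t)$, $\pi_\lambda(t)=\lambda e^{-\lambda t}$. A power density is $\varrho\in\mathfrak{D}$ of the form $\varrho(t)=(\alpha+\beta t)^{-\gamma}$ with $\alpha,\beta,\gamma>0$. *)

theory Defs
  imports "HOL-Analysis.Analysis"
begin

text \<open>Maps from R+ are represented as functions on real; only values at t \<ge> 0 are used.
  Costs c : K \<rightarrow> R are represented as functions on all of (real \<Rightarrow> 'w); only their
  values on K matter (by monotonicity, V depends only on the restriction to K).\<close>

definition game_mapping ::
  "(real \<Rightarrow> 'w) set \<Rightarrow> (((real \<Rightarrow> 'w) \<Rightarrow> real) \<Rightarrow> 'w \<Rightarrow> real) \<Rightarrow> bool" where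
  "game_mapping K V \<longleftrightarrow>
     (\<forall>c. bounded (c ` K) \<longrightarrow> bounded (range (V c))) \<and>
     (\<forall>c (A::real) B. bounded (c ` K) \<and> A \<ge> 0 \<longrightarrow>
         V (\<lambda>z. A * c z + B) = (\<lambda>\<omega>. A * V c \<omega> + B)) \<and>
     (\<forall>c1 c2. bounded (c1 ` K) \<and> bounded (c2 ` K) \<and> (\<forall>z\<in>K. c1 z \<le> c2 z) \<longrightarrow>
         (\<forall>\<omega>. V c1 \<omega> \<le> V c2 \<omega>))"

definition prob_density :: "(real \<Rightarrow> real) \<Rightarrow> bool" where
  "prob_density \<rho> \<longleftrightarrow> (\<forall>t\<ge>0. \<rho> t \<ge> 0) \<and> (\<rho> has_integral 1) {0..}"

definition shift_density :: "(real \<Rightarrow> real) \<Rightarrow> real \<Rightarrow> real \<Rightarrow> real" where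
  "shift_density \<rho> T = (\<lambda>t. \<rho> (t + T) / integral {T..} \<rho>)"

definition scale_density :: "(real \<Rightarrow> real) \<Rightarrow> real \<Rightarrow> real \<Rightarrow> real" where
  "scale_density \<rho> l = (\<lambda>t. l * \<rho> (l * t))"

definition cost :: "('w \<Rightarrow> real) \<Rightarrow> (real \<Rightarrow> real) \<Rightarrow> (real \<Rightarrow> 'w) \<Rightarrow> real" where
  "cost g \<rho> z = integral {0..} (\<lambda>t. \<rho> t * g (z t))"

definition dcost ::
  "('w \<Rightarrow> real) \<Rightarrow> (((real \<Rightarrow> 'w) \<Rightarrow> real) \<Rightarrow> 'w \<Rightarrow> real) \<Rightarrow> (real \<Rightarrow> real) \<Rightarrow> real
     \<Rightarrow> (real \<Rightarrow> 'w) \<Rightarrow> real" where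
  "dcost g V \<rho> T z = integral {0..T} (\<lambda>t. \<rho> t * g (z t))
      + integral {T..} \<rho> * V (cost g (shift_density \<rho> T)) (z T)"

definition discrete_DPP ::
  "('w \<Rightarrow> real) \<Rightarrow> (((real \<Rightarrow> 'w) \<Rightarrow> real) \<Rightarrow> 'w \<Rightarrow> real) \<Rightarrow> bool" where
  "discrete_DPP g V \<longleftrightarrow>
     (\<forall>\<rho> (n::nat). prob_density \<rho> \<and> n \<ge> 1 \<and> integral {real n..} \<rho> > 0 \<longrightarrow>
        V (dcost g V \<rho> (real n)) = V (cost g \<rho>))"

definition unif_density :: "real \<Rightarrow> real \<Rightarrow> real" where
  "unif_density T = (\<lambda>t. (1 / T) * indicator {0..T} t)"

definition exp_density :: "real \<Rightarrow> real \<Rightarrow> real" where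
  "exp_density l = (\<lambda>t. l * exp (- l * t))"

definition power_density :: "(real \<Rightarrow> real) \<Rightarrow> bool" where
  "power_density \<rho> \<longleftrightarrow> prob_density \<rho> \<and>
     (\<exists>\<alpha> \<beta> \<gamma>::real. \<alpha> > 0 \<and> \<beta> > 0 \<and> \<gamma> > 0 \<and> (\<forall>t\<ge>0. \<rho> t = (\<alpha> + \<beta> * t) powr (- \<gamma>)))"

definition piecewise_continuous_pos :: "(real \<Rightarrow> real) \<Rightarrow> bool" where
  "piecewise_continuous_pos f \<longleftrightarrow>
     (\<forall>a b. 0 < a \<longrightarrow> finite {x\<in>{a..b}. \<not> isCont f x}) \<and>
     (\<forall>x>0. (\<exists>l. (f \<longlongrightarrow> l) (at_left x)) \<and> (\<exists>r. (f \<longlongrightarrow> r) (at_right x)))"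

definition Val :: "('w \<Rightarrow> real) \<Rightarrow> (((real \<Rightarrow> 'w) \<Rightarrow> real) \<Rightarrow> 'w \<Rightarrow> real) \<Rightarrow> (real \<Rightarrow> real) \<Rightarrow> 'w \<Rightarrow> real" where
  "Val g V \<rho> = V (cost g \<rho>)"

end

theory Submission
  imports Defs
begin

text \<open>
  Write \<open>F n f\<close> for the value of the payoff \<open>\<integral>\<^sub>0\<^sup>n g(z(t)) dt + f(z(n))\<close>. Since \<open>V\<close> is nonexpansive,
  the value of a density depends on it in an \<open>L\<^sup>1\<close>-Lipschitz way, and by dynamic programming the
  whole theorem reduces to the block estimate \<open>F n (r U) \<approx> (n + r) U\<close>.

  If the values of the uniform densities converge to \<open>U\<close>, dynamic programming for the uniform
  density on \<open>[0, n + r]\<close> gives the block estimate. Applying it block by block, from the last block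
  to the first, gives the convergence for slowly scaled positive step functions, hence by
  \<open>L\<^sup>1\<close>-approximation for every scaled density. Exponential densities and shifted power densities are
  scaled densities.

  Conversely, an exponential or shifted power density is almost constant, equal to \<open>1 / (n + N)\<close>, on
  \<open>[0, N]\<close> with \<open>N \<approx> \<delta> n\<close>, up to an \<open>L\<^sup>1\<close>-error \<open>O(\<delta>\<^sup>2)\<close>. If its value and that of its shift by \<open>N\<close>
  are close to \<open>U\<close>, then \<open>F N (n U) = (n + N) U + O(\<delta> N)\<close>. These errors add up to \<open>O(\<delta> n)\<close>
  when the horizon grows from a fixed length to \<open>n\<close>, so the uniform values converge to \<open>U\<close>.
\<close>

section \<open>Integration on half-lines\<close>

text \<open>Two constraints shape the argument. Dynamic programming is available at integer times
  only, so blocks have integer length, and the rounding is absorbed because they are long. And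
  \<open>F n (r U)\<close> is controlled only for large \<open>r\<close>. On a block where the
  density has height \<open>h\<close>, the relevant \<open>r\<close> is the mass still to come
  divided by \<open>h\<close>. This quotient stays large if the later heights do not drop to zero;
  hence step functions bounded below by a positive multiple of the scale. Their number of steps is
  fixed before the scale tends to 0, since every block adds one more error.

  In the converse direction the estimate for \<open>F N (n U)\<close> comes from multiplying a
  relation of size 1 by n + N. A value error \<epsilon> becomes \<epsilon> (n + N), while only a
  multiple of \<delta> N is affordable per block, so \<epsilon> is chosen after the ratio N / n. By
  the same count a deviation O(\<delta>^2) of the density from a constant is harmless, whereas
  O(\<delta>) would cost as much as the block itself.\<close>

lemma integral_affine_halfline:
  fixes f :: "real \<Rightarrow> real"
  assumes f: "f absolutely_integrable_on {l * a + b..}" and l: "l > 0"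
  shows "(\<lambda>t. f (l * t + b)) absolutely_integrable_on {a..}"
    and "integral {a..} (\<lambda>t. f (l * t + b)) = integral {l * a + b..} f / l"
proof -
  have im: "(\<lambda>t. l * t + b) ` {a..} = {l * a + b..}"
  proof (intro equalityI subsetI)
    fix y assume "y \<in> {l * a + b..}"
    then have "y = l * ((y - b) / l) + b" "(y - b) / l \<ge> a"
      using l by (auto simp: field_simps)
    then show "y \<in> (\<lambda>t. l * t + b) ` {a..}" by blast
  qed (use l in auto)
  have *: "(\<lambda>t. \<bar>l\<bar> * f (l * t + b)) absolutely_integrable_on {a..} \<and>
        integral {a..} (\<lambda>t. \<bar>l\<bar> * f (l * t + b)) = integral {l * a + b..} f"
    by (subst has_absolute_integral_change_of_variables_1'[where g = "\<lambda>t. l * t + b"])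
       (use f l im in \<open>auto intro!: derivative_eq_intros inj_onI\<close>)
  then have "(\<lambda>t. inverse l * (\<bar>l\<bar> * f (l * t + b))) absolutely_integrable_on {a..}"
    by (intro set_integrable_mult_right) auto
  then show "(\<lambda>t. f (l * t + b)) absolutely_integrable_on {a..}"
    using l by (simp add: field_simps)
  show "integral {a..} (\<lambda>t. f (l * t + b)) = integral {l * a + b..} f / l"
    using * l by (simp add: field_simps)
qed

lemma integral_shift_halfline:
  fixes f :: "real \<Rightarrow> real"
  assumes f: "f absolutely_integrable_on {0..}" and n: "0 \<le> n"
  shows "(\<lambda>t. f (t + n)) absolutely_integrable_on {0..}"
    and "integral {0..} (\<lambda>t. f (t + n)) = integral {n..} f"
  using integral_affine_halfline[where f = f and l = 1 and a = 0 and b = n] set_integrable_subset[OF f, of "{n..}"] n by simp_all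

lemma integral_halfline_split:
  fixes f :: "real \<Rightarrow> real"
  assumes f: "f absolutely_integrable_on {a..}" and "a \<le> b"
  shows "integral {a..} f = integral {a..b} f + integral {b..} f"
proof -
  have "f absolutely_integrable_on {a..b}" "f absolutely_integrable_on {b..}"
    using assms by (auto intro: set_integrable_subset[OF f])
  then have "(f has_integral (integral {a..b} f + integral {b..} f)) ({a..b} \<union> {b..})"
    using assms by (intro has_integral_Un integrable_integral)
      (auto simp: absolutely_integrable_on_def intro!: negligible_subset[of "{b}"])
  moreover have "{a..b} \<union> {b..} = {a..}" using assms by auto
  ultimately show ?thesis by (simp add: integral_unique)
qed

text \<open>Dominated convergence works along sequences, so the limit at infinity is tested on an
  arbitrary sequence \<open>X\<close>. The truncations to \<open>{0..X k}\<close> are dominated by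
  \<bar>f\<bar> and at each point eventually equal to \<open>f\<close>.\<close>

lemma integral_tail_tendsto_0:
  fixes f :: "real \<Rightarrow> real"
  assumes f: "f absolutely_integrable_on {0..}"
  shows "((\<lambda>b. integral {b..} f) \<longlongrightarrow> 0) at_top"
proof -
  have "((\<lambda>b. integral {0..b} f) \<longlongrightarrow> integral {0..} f) at_top"
  proof (rule tendsto_at_topI_sequentially)
    fix X :: "nat \<Rightarrow> real" assume X: "filterlim X at_top sequentially"
    let ?h = "\<lambda>k t. if t \<in> {0..X k} then f t else 0"
    have fk: "f absolutely_integrable_on {0..X k}" for k
      by (rule set_integrable_subset[OF f]) auto
    have "?h k integrable_on {0..}" for k
      using fk[of k] by (subst integrable_restrict_Int)
        (auto simp: absolutely_integrable_on_def intro!: back_subst[of "\<lambda>S. f integrable_on S"])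
    moreover have "(\<lambda>t. \<bar>f t\<bar>) integrable_on {0..}"
      using f by (auto simp: absolutely_integrable_on_def)
    moreover have "(\<lambda>k. ?h k t) \<longlonglongrightarrow> f t" if "t \<in> {0..}" for t
    proof (rule tendsto_eventually)
      have "eventually (\<lambda>k. t \<le> X k) sequentially"
        using X by (simp add: filterlim_at_top)
      then show "eventually (\<lambda>k. ?h k t = f t) sequentially"
        by eventually_elim (use that in auto)
    qed
    ultimately have "(\<lambda>k. integral {0..} (?h k)) \<longlonglongrightarrow> integral {0..} f"
      by (intro dominated_convergence(2)[where h = "\<lambda>t. \<bar>f t\<bar>"]) auto
    moreover have "integral {0..} (?h k) = integral {0..X k} f" for k
      by (subst integral_restrict_Int) (auto simp: Int_absorb1 Int_absorb2)
    ultimately show "(\<lambda>k. integral {0..X k} f) \<longlonglongrightarrow> integral {0..} f" by simp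
  qed
  then have "((\<lambda>b. integral {0..} f - integral {0..b} f) \<longlongrightarrow> 0) at_top"
    by (auto intro: tendsto_eq_intros)
  moreover have "eventually (\<lambda>b. integral {0..} f - integral {0..b} f = integral {b..} f) at_top"
    using eventually_ge_at_top[of 0]
    by eventually_elim (use integral_halfline_split[OF f] in auto)
  ultimately show ?thesis by (rule Lim_transform_eventually)
qed

text \<open>Measurability yields continuous functions converging to \<open>f\<close> off a null set,
  but without a common bound. Cutting \<open>f\<close> at a large height \<open>k\<close> costs
  little in L1, and clamping the continuous functions to [0, k] keeps them continuous and
  nonnegative and supplies the dominating constant \<open>k\<close>.\<close>

lemma continuous_L1_approximation:
  fixes f :: "real \<Rightarrow> real"
  assumes f: "f absolutely_integrable_on {a..b}" and nonneg: "\<And>t. t \<in> {a..b} \<Longrightarrow> 0 \<le> f t"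
    and e: "0 < e"
  obtains \<phi> where "continuous_on UNIV \<phi>" "\<And>t. 0 \<le> \<phi> t" "integral {a..b} (\<lambda>t. \<bar>f t - \<phi> t\<bar>) < e"
proof -
  have meas: "f \<in> borel_measurable (lebesgue_on {a..b})"
    using f by (simp add: absolutely_integrable_measurable)
  then have "f measurable_on {a..b}"
    by (simp add: measurable_on_iff_borel_measurable)
  then obtain N h where N: "negligible N" and h: "\<And>n. continuous_on UNIV (h n)"
    and lim: "\<And>x. x \<notin> N \<Longrightarrow> (\<lambda>n. h n x) \<longlonglongrightarrow> (if x \<in> {a..b} then f x else 0)"
    unfolding measurable_on_def by blast
  define m where "m k t = min (f t) (real k)" for k t
  have mint: "m k absolutely_integrable_on {a..b}" for k
    unfolding m_def by (intro absolutely_integrable_min_1 f) (auto simp: absolutely_integrable_on_const)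
  have m_le: "0 \<le> m k t \<and> m k t \<le> f t" if "t \<in> {a..b}" for k t
    using nonneg[OF that] by (auto simp: m_def)
  have fi: "f integrable_on {a..b}" and mi: "m k integrable_on {a..b}" for k
    using f mint by (auto simp: absolutely_integrable_on_def)
  have "(\<lambda>k. integral {a..b} (\<lambda>t. f t - m k t)) \<longlonglongrightarrow> integral {a..b} (\<lambda>t. 0)"
  proof (rule dominated_convergence(2)[where h = f])
    fix t assume "t \<in> {a..b}"
    obtain n where n: "f t \<le> real n" using real_arch_simple by blast
    have "eventually (\<lambda>k. f t - m k t = 0) sequentially"
      using eventually_ge_at_top[of n] by eventually_elim (use n in \<open>auto simp: m_def\<close>)
    then show "(\<lambda>k. f t - m k t) \<longlonglongrightarrow> 0" by (rule tendsto_eventually)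
  qed (use nonneg m_le in \<open>auto intro!: integrable_diff fi mi\<close>)
  then have "(\<lambda>k. integral {a..b} (\<lambda>t. f t - m k t)) \<longlonglongrightarrow> 0" by simp
  then have "eventually (\<lambda>k. integral {a..b} (\<lambda>t. f t - m k t) < e / 2) sequentially"
    using e by (intro order_tendstoD(2)) auto
  then obtain k where k: "integral {a..b} (\<lambda>t. f t - m k t) < e / 2"
    by (auto simp: eventually_sequentially)
  define \<phi> where "\<phi> n t = max 0 (min (h n t) (real k))" for n t
  have cont: "continuous_on UNIV (\<phi> n)" for n
    unfolding \<phi>_def by (intro continuous_intros h)
  have \<phi>int: "\<phi> n absolutely_integrable_on {a..b}" for n
    by (rule absolutely_integrable_continuous_real) (rule continuous_on_subset[OF cont], simp)
  have mk: "(\<lambda>t. \<bar>m k t - \<phi> n t\<bar>) absolutely_integrable_on {a..b}" for n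
    using set_integrable_abs[OF set_integral_diff(1)[OF mint \<phi>int]] .
  have "(\<lambda>n. integral ({a..b} - N) (\<lambda>t. \<bar>m k t - \<phi> n t\<bar>)) \<longlonglongrightarrow> integral ({a..b} - N) (\<lambda>t. 0)"
  proof (rule dominated_convergence(2)[where h = "\<lambda>_. real k"])
    fix n
    show "(\<lambda>t. \<bar>m k t - \<phi> n t\<bar>) integrable_on {a..b} - N"
      by (rule integrable_spike_set[of _ "{a..b}"])
        (use mk[of n] in \<open>auto simp: absolutely_integrable_on_def intro: negligible_subset[OF N]\<close>)
    show "(\<lambda>_. real k) integrable_on {a..b} - N"
      by (rule integrable_spike_set[of _ "{a..b}"]) (auto intro: negligible_subset[OF N])
  next
    fix n t assume "t \<in> {a..b} - N"
    then show "norm \<bar>m k t - \<phi> n t\<bar> \<le> real k"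
      using nonneg[of t] by (auto simp: m_def \<phi>_def max_def min_def abs_if)
  next
    fix t assume t: "t \<in> {a..b} - N"
    then have "(\<lambda>n. h n t) \<longlonglongrightarrow> f t" using lim[of t] by auto
    then have "(\<lambda>n. \<bar>m k t - max 0 (min (h n t) (real k))\<bar>) \<longlonglongrightarrow> \<bar>m k t - max 0 (min (f t) (real k))\<bar>"
      by (intro tendsto_intros)
    moreover have "max 0 (min (f t) (real k)) = m k t" using nonneg[of t] t by (auto simp: m_def)
    ultimately show "(\<lambda>n. \<bar>m k t - \<phi> n t\<bar>) \<longlonglongrightarrow> 0" by (simp add: \<phi>_def)
  qed
  moreover have "integral ({a..b} - N) (\<lambda>t. \<bar>m k t - \<phi> n t\<bar>) = integral {a..b} (\<lambda>t. \<bar>m k t - \<phi> n t\<bar>)" for n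
    by (rule integral_spike_set) (auto intro: negligible_subset[OF N])
  ultimately have "(\<lambda>n. integral {a..b} (\<lambda>t. \<bar>m k t - \<phi> n t\<bar>)) \<longlonglongrightarrow> 0" by simp
  then have "eventually (\<lambda>n. integral {a..b} (\<lambda>t. \<bar>m k t - \<phi> n t\<bar>) < e / 2) sequentially"
    using e by (intro order_tendstoD(2)) auto
  then obtain n where n: "integral {a..b} (\<lambda>t. \<bar>m k t - \<phi> n t\<bar>) < e / 2"
    by (auto simp: eventually_sequentially)
  have i1: "(\<lambda>t. f t - m k t) integrable_on {a..b}"
    using f mint by (auto simp: absolutely_integrable_on_def intro: integrable_diff)
  have i2: "(\<lambda>t. \<bar>m k t - \<phi> n t\<bar>) integrable_on {a..b}"
    using mk by (simp add: absolutely_integrable_on_def)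
  have "integral {a..b} (\<lambda>t. \<bar>f t - \<phi> n t\<bar>)
      \<le> integral {a..b} (\<lambda>t. (f t - m k t) + \<bar>m k t - \<phi> n t\<bar>)"
  proof (rule integral_le)
    show "(\<lambda>t. \<bar>f t - \<phi> n t\<bar>) integrable_on {a..b}"
      using set_integrable_abs[OF set_integral_diff(1)[OF f \<phi>int]]
      by (simp add: absolutely_integrable_on_def)
    show "(\<lambda>t. (f t - m k t) + \<bar>m k t - \<phi> n t\<bar>) integrable_on {a..b}"
      by (intro integrable_add i1 i2)
  qed (auto simp: m_def)
  also have "\<dots> < e" using k n by (subst integral_add[OF i1 i2]) simp
  finally show thesis by (intro that[of "\<phi> n"] cont) (auto simp: \<phi>_def)
qed

text \<open>The sandwich hypothesis covers open, half-open and closed intervals at once: they differ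
  from [a, b] at the endpoints only.\<close>

lemma has_integral_indicator_halfline:
  fixes a b :: real
  assumes "0 \<le> a" "a \<le> b" "{a<..<b} \<subseteq> A" "A \<subseteq> {a..b}"
  shows "((indicator A :: real \<Rightarrow> real) has_integral (b - a)) {0..}"
proof -
  have "((\<lambda>_. 1::real) has_integral (b - a)) {a..b}"
    using has_integral_const_real[of "1::real" a b] assms by simp
  then have "((indicator A :: real \<Rightarrow> real) has_integral (b - a)) {a..b}"
    by (rule has_integral_spike_finite[of "{a, b}", rotated 2])
      (use assms in \<open>auto simp: indicator_def subset_iff\<close>)
  then show ?thesis
    by (rule has_integral_on_superset) (use assms in \<open>auto simp: indicator_def\<close>)
qed

lemma has_integral_nonneg_absolutely:
  fixes f :: "real \<Rightarrow> real"
  assumes "(f has_integral I) S" "\<And>x. x \<in> S \<Longrightarrow> 0 \<le> f x"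
  shows "f absolutely_integrable_on S"
  using assms by (intro nonnegative_absolutely_integrable_1) auto

lemma indicator_atLeastAtMost_has_integral:
  fixes b :: real
  assumes "0 \<le> b"
  shows "((indicator {0..b} :: real \<Rightarrow> real) has_integral b) {0..}"
proof -
  have "((indicator {0..b} :: real \<Rightarrow> real) has_integral (b - 0)) {0..}"
    by (rule has_integral_indicator_halfline) (use assms in \<open>auto simp: subset_iff\<close>)
  then show ?thesis by simp
qed

lemma indicator_absolutely_integrable:
  fixes b :: real
  assumes "0 \<le> b"
  shows "(indicator {0..b} :: real \<Rightarrow> real) absolutely_integrable_on {0..}"
  using indicator_atLeastAtMost_has_integral[OF assms] by (rule has_integral_nonneg_absolutely) auto

lemma integral_abs_diff_le:
  fixes f k :: "real \<Rightarrow> real"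
  assumes "f absolutely_integrable_on S" "k absolutely_integrable_on S"
  shows "\<bar>integral S f - integral S k\<bar> \<le> integral S (\<lambda>t. \<bar>f t - k t\<bar>)"
proof -
  have "(\<lambda>t. f t - k t) absolutely_integrable_on S" using assms by (rule set_integral_diff(1))
  then have "norm (integral S (\<lambda>t. f t - k t)) \<le> integral S (\<lambda>t. \<bar>f t - k t\<bar>)"
    by (intro integral_norm_bound_integral) (auto simp: absolutely_integrable_on_def)
  then show ?thesis
    using assms by (simp add: absolutely_integrable_on_def integral_diff)
qed

text \<open>Boundedness is what makes the real-valued supremum an upper bound; over an unbounded
  family it carries no information.\<close>

lemma SUP_tendsto_0_iff_uniform_limit:
  fixes f :: "'a \<Rightarrow> 'b \<Rightarrow> real"
  assumes bdd: "eventually (\<lambda>x. bounded (range (\<lambda>\<omega>. f x \<omega> - U \<omega>))) F"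
  shows "((\<lambda>x. SUP \<omega>. \<bar>f x \<omega> - U \<omega>\<bar>) \<longlongrightarrow> 0) F \<longleftrightarrow> uniform_limit UNIV f U F"
proof
  have upper: "\<bar>f x \<omega> - U \<omega>\<bar> \<le> (SUP \<omega>. \<bar>f x \<omega> - U \<omega>\<bar>)" if b: "bounded (range (\<lambda>\<omega>. f x \<omega> - U \<omega>))" for x \<omega>
  proof (rule cSUP_upper)
    obtain B where "\<And>\<omega>. \<bar>f x \<omega> - U \<omega>\<bar> \<le> B" using b by (auto simp: bounded_iff)
    then show "bdd_above (range (\<lambda>\<omega>. \<bar>f x \<omega> - U \<omega>\<bar>))" by (auto intro!: bdd_aboveI)
  qed simp
  {
    assume L: "((\<lambda>x. SUP \<omega>. \<bar>f x \<omega> - U \<omega>\<bar>) \<longlongrightarrow> 0) F"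
    show "uniform_limit UNIV f U F"
    proof (rule uniform_limitI)
      fix e :: real assume "e > 0"
      with L have "eventually (\<lambda>x. (SUP \<omega>. \<bar>f x \<omega> - U \<omega>\<bar>) < e) F" by (rule order_tendstoD(2))
      then show "\<forall>\<^sub>F x in F. \<forall>\<omega>\<in>UNIV. dist (f x \<omega>) (U \<omega>) < e"
        using bdd by eventually_elim (use upper in \<open>auto simp: dist_real_def intro: le_less_trans\<close>)
    qed
  next
    assume L: "uniform_limit UNIV f U F"
    show "((\<lambda>x. SUP \<omega>. \<bar>f x \<omega> - U \<omega>\<bar>) \<longlongrightarrow> 0) F"
    proof (rule tendstoI)
      fix e :: real assume e: "e > 0"
      have "\<forall>\<^sub>F x in F. \<forall>\<omega>\<in>UNIV. dist (f x \<omega>) (U \<omega>) < e / 2"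
        using L e by (intro uniform_limitD) auto
      then show "\<forall>\<^sub>F x in F. dist (SUP \<omega>. \<bar>f x \<omega> - U \<omega>\<bar>) 0 < e"
        using bdd
      proof eventually_elim
        case (elim x)
        \<comment> \<open>A supremum of quantities below a bound is only weakly below it, hence e /
          2 instead of e.\<close>
        have "(SUP \<omega>. \<bar>f x \<omega> - U \<omega>\<bar>) \<le> e / 2"
          using elim(1) by (intro cSUP_least) (auto simp: dist_real_def less_imp_le)
        moreover have "0 \<le> (SUP \<omega>. \<bar>f x \<omega> - U \<omega>\<bar>)"
          using order_trans[OF abs_ge_zero upper[OF elim(2), of undefined]] .
        ultimately show ?case using e by simp
      qed
    qed
  }
qed

section \<open>Densities\<close>

lemma prob_density_absolutely_integrable:
  assumes "prob_density \<rho>"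
  shows "\<rho> absolutely_integrable_on {0..}"
  using assms unfolding prob_density_def by (auto intro: has_integral_nonneg_absolutely)

lemma prob_density_scale:
  assumes \<mu>: "prob_density \<mu>" and l: "l > 0"
  shows "prob_density (scale_density \<mu> l)"
proof -
  note aff = integral_affine_halfline[where f = \<mu> and l = l and a = 0 and b = 0]
  have i: "\<mu> absolutely_integrable_on {0..}" by (rule prob_density_absolutely_integrable[OF \<mu>])
  have "integral {0..} \<mu> = 1" using \<mu> by (simp add: prob_density_def integral_unique)
  then have "integral {0..} (\<lambda>t. \<mu> (l * t)) = 1 / l" using aff(2) i l by simp
  moreover have "(\<lambda>t. \<mu> (l * t)) integrable_on {0..}"
    using aff(1) i l by (simp add: absolutely_integrable_on_def)
  ultimately have "((\<lambda>t. \<mu> (l * t)) has_integral (1 / l)) {0..}"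
    by (metis integrable_integral)
  from has_integral_mult_right[OF this, of l] show ?thesis
    using \<mu> l by (auto simp: prob_density_def scale_density_def)
qed

lemma exp_density_tail_has_integral:
  assumes "l > 0"
  shows "(exp_density l has_integral exp (- l * c)) {c..}"
  using has_integral_mult_right[OF has_integral_exp_minus_to_infinity[OF assms, of c], of l] assms
  by (simp add: exp_density_def)

lemma prob_density_exp:
  assumes "l > 0"
  shows "prob_density (exp_density l)"
  using exp_density_tail_has_integral[OF assms, of 0] assms by (simp add: prob_density_def exp_density_def)

lemma prob_density_unif:
  assumes "T > 0"
  shows "prob_density (unif_density T)"
  using has_integral_mult_right[OF indicator_atLeastAtMost_has_integral, of T "1 / T"] assms
  by (simp add: prob_density_def unif_density_def)

lemma scale_unif_density: "l > 0 \<Longrightarrow> scale_density (unif_density 1) l = unif_density (1 / l)"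
  by (auto simp: scale_density_def unif_density_def indicator_def field_simps zero_le_mult_iff fun_eq_iff)

lemma scale_exp_density: "scale_density (exp_density 1) l = exp_density l"
  by (auto simp: scale_density_def exp_density_def)

text \<open>Memorylessness of the exponential law. It lets one estimate for
  \<open>exp_density l\<close> serve both for the density and for what remains of it after a
  block.\<close>

lemma shift_exp_density:
  assumes "l > 0"
  shows "shift_density (exp_density l) T = exp_density l"
  unfolding shift_density_def integral_unique[OF exp_density_tail_has_integral[OF assms]]
  by (auto simp: exp_density_def field_simps exp_add[symmetric])

text \<open>Admits \<open>exp_density 1\<close> as a test density in condition (c); its scalings are
  exactly the densities of condition (e).\<close>

lemma piecewise_continuous_exp_density: "piecewise_continuous_pos (exp_density 1)"
proof -
  have c: "isCont (exp_density 1) x" for x unfolding exp_density_def by (intro continuous_intros)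
  then have "(exp_density 1 \<longlongrightarrow> exp_density 1 x) (at_left x)" "(exp_density 1 \<longlongrightarrow> exp_density 1 x) (at_right x)" for x
    by (auto simp: isCont_def intro: tendsto_within_subset)
  then show ?thesis using c unfolding piecewise_continuous_pos_def by auto
qed

section \<open>Power densities, their tails and their shifts\<close>

lemma powr_tail_has_integral:
  fixes \<alpha> \<beta> \<gamma> T :: real
  assumes "\<alpha> > 0" "\<beta> > 0" "\<gamma> > 1" "T \<ge> 0"
  shows "((\<lambda>t. (\<alpha> + \<beta> * t) powr (- \<gamma>)) has_integral (\<alpha> + \<beta> * T) powr (1 - \<gamma>) / (\<beta> * (\<gamma> - 1))) {T..}"
proof -
  have pos: "\<beta> * T + \<alpha> > 0" using assms by (simp add: add_nonneg_pos)
  have "- ((\<beta> * T + \<alpha>) powr (- \<gamma> + 1)) / (- \<gamma> + 1) = (\<beta> * T + \<alpha>) powr (1 - \<gamma>) / (\<gamma> - 1)"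
  proof -
    have "- \<gamma> + 1 = - (\<gamma> - 1)" "1 - \<gamma> = - (\<gamma> - 1)" by simp_all
    then show ?thesis by (simp only: minus_divide_divide)
  qed
  then have I: "((\<lambda>x. x powr (- \<gamma>)) has_integral (\<beta> * T + \<alpha>) powr (1 - \<gamma>) / (\<gamma> - 1)) {\<beta> * T + \<alpha>..}"
    using has_integral_powr_to_inf[of "- \<gamma>" "\<beta> * T + \<alpha>"] assms pos by simp
  then have "(\<lambda>x. x powr (- \<gamma>)) absolutely_integrable_on {\<beta> * T + \<alpha>..}"
    by (rule has_integral_nonneg_absolutely) simp
  from integral_affine_halfline[OF this assms(2)] integral_unique[OF I]
  have "(\<lambda>t. (\<beta> * t + \<alpha>) powr (- \<gamma>)) integrable_on {T..}"
    "integral {T..} (\<lambda>t. (\<beta> * t + \<alpha>) powr (- \<gamma>)) = (\<beta> * T + \<alpha>) powr (1 - \<gamma>) / (\<beta> * (\<gamma> - 1))"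
    by (simp_all add: absolutely_integrable_on_def mult.commute)
  then show ?thesis by (metis (no_types, lifting) add.commute ext integrable_integral)
qed

text \<open>The harmonic series argument: for \<gamma> \<le> 1 every interval [x, 2x] far out
  carries mass at least 1 / (3 \<beta>), against the vanishing of the tail. Here x \<ge> \<alpha> /
  \<beta> gives \<alpha> + \<beta> t \<le> 3 \<beta> x, and x \<ge> 1 / \<beta> makes the base at
  least 1, so that lowering the exponent from 1 to \<gamma> can only increase the density.\<close>

lemma power_density_exponent_gt_1:
  assumes \<rho>: "prob_density \<rho>" and \<alpha>: "\<alpha> > 0" and \<beta>: "\<beta> > 0"
    and eq: "\<And>t. t \<ge> 0 \<Longrightarrow> \<rho> t = (\<alpha> + \<beta> * t) powr (- \<gamma>)"
  shows "\<gamma> > 1"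
proof (rule ccontr)
  assume "\<not> \<gamma> > 1"
  then have \<gamma>: "\<gamma> \<le> 1" by simp
  have \<rho>i: "\<rho> absolutely_integrable_on {0..}" by (rule prob_density_absolutely_integrable[OF \<rho>])
  have \<rho>0: "\<rho> t \<ge> 0" if "t \<ge> 0" for t using \<rho> that by (simp add: prob_density_def)
  have lower: "integral {x..} \<rho> \<ge> 1 / (3 * \<beta>)" if x: "x \<ge> \<alpha> / \<beta>" "x \<ge> 1 / \<beta>" for x
  proof -
    have x0: "x > 0" using x(2) \<beta> by (meson divide_pos_pos less_le_trans zero_less_one)
    have bx: "\<beta> * x \<ge> \<alpha>" "\<beta> * x \<ge> 1" using x \<beta> by (auto simp: field_simps)
    have sub: "\<rho> absolutely_integrable_on {x..2 * x}" "\<rho> absolutely_integrable_on {2 * x..}"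
      "\<rho> absolutely_integrable_on {x..}"
      using x0 by (auto intro!: set_integrable_subset[OF \<rho>i])
    have "1 / (3 * \<beta>) = integral {x..2 * x} (\<lambda>_. 1 / (3 * \<beta> * x))" using x0 \<beta> by simp
    also have "\<dots> \<le> integral {x..2 * x} \<rho>"
    proof (rule integral_le)
      fix t assume t: "t \<in> {x..2 * x}"
      then have "\<beta> * t \<le> \<beta> * (2 * x)" "\<beta> * x \<le> \<beta> * t" using \<beta> by (auto intro!: mult_left_mono)
      then have b: "1 \<le> \<alpha> + \<beta> * t" "\<alpha> + \<beta> * t \<le> 3 * \<beta> * x" using bx \<alpha> by auto
      then have "1 / (3 * \<beta> * x) \<le> 1 / (\<alpha> + \<beta> * t)" by (intro divide_left_mono) (use b in auto)
      also have "\<dots> = (\<alpha> + \<beta> * t) powr (- 1)" using b by (simp add: powr_minus_divide)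
      also have "\<dots> \<le> (\<alpha> + \<beta> * t) powr (- \<gamma>)" using b \<gamma> by (intro powr_mono) auto
      also have "\<dots> = \<rho> t" using eq[of t] t x0 by simp
      finally show "1 / (3 * \<beta> * x) \<le> \<rho> t" .
    qed (use sub in \<open>auto simp: absolutely_integrable_on_def\<close>)
    also have "\<dots> \<le> integral {x..} \<rho>"
    proof -
      have "integral {2 * x..} \<rho> \<ge> 0"
        using sub \<rho>0 x0 by (intro integral_nonneg) (auto simp: absolutely_integrable_on_def)
      then show ?thesis using integral_halfline_split[OF sub(3), of "2 * x"] x0 by simp
    qed
    finally show ?thesis .
  qed
  have "eventually (\<lambda>x. integral {x..} \<rho> < 1 / (3 * \<beta>)) at_top"
    using integral_tail_tendsto_0[OF \<rho>i] \<beta> by (intro order_tendstoD(2)) auto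
  then have "eventually (\<lambda>x::real. False) at_top"
    using eventually_ge_at_top[of "\<alpha> / \<beta>"] eventually_ge_at_top[of "1 / \<beta>"]
    by eventually_elim (use lower in force)
  then show False by simp
qed

text \<open>The Lomax (shifted Pareto) density of unit scale: up to scaling, the common form of all
  power densities with exponent \<gamma> and of their shifts.\<close>

definition power_profile :: "real \<Rightarrow> real \<Rightarrow> real" where
  "power_profile \<gamma> t = (\<gamma> - 1) * (1 + t) powr (- \<gamma>)"

lemma prob_density_power_profile:
  assumes "\<gamma> > 1"
  shows "prob_density (power_profile \<gamma>)"
  using has_integral_mult_right[OF powr_tail_has_integral[of 1 1 \<gamma> 0], of "\<gamma> - 1"] assms
  by (simp add: prob_density_def power_profile_def[abs_def])

text \<open>With a = \<alpha> + \<beta> T one has \<alpha> + \<beta> (t + T) = a (1 + (\<beta> / a)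
  t), and the powers of a combine with the tail mass. So shifting is scaling by \<beta> / a, which
  tends to 0 as T grows; this ties conditions (p) and (q) to scaled densities.\<close>

lemma power_density_shift:
  assumes \<alpha>: "\<alpha> > 0" and \<beta>: "\<beta> > 0" and \<gamma>: "\<gamma> > 1" and T: "T \<ge> 0"
    and eq: "\<And>t. t \<ge> 0 \<Longrightarrow> \<rho> t = (\<alpha> + \<beta> * t) powr (- \<gamma>)"
  shows "integral {T..} \<rho> = (\<alpha> + \<beta> * T) powr (1 - \<gamma>) / (\<beta> * (\<gamma> - 1))"
    and "t \<ge> 0 \<Longrightarrow> shift_density \<rho> T t = scale_density (power_profile \<gamma>) (\<beta> / (\<alpha> + \<beta> * T)) t"
proof -
  define a where "a = \<alpha> + \<beta> * T"
  have a: "a > 0" unfolding a_def using \<alpha> \<beta> T by (intro add_pos_nonneg) auto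
  have "integral {T..} \<rho> = integral {T..} (\<lambda>t. (\<alpha> + \<beta> * t) powr (- \<gamma>))"
    using eq T by (intro integral_cong) auto
  then show I: "integral {T..} \<rho> = (\<alpha> + \<beta> * T) powr (1 - \<gamma>) / (\<beta> * (\<gamma> - 1))"
    using integral_unique[OF powr_tail_has_integral[OF \<alpha> \<beta> \<gamma> T]] by simp
  assume t: "t \<ge> 0"
  have "\<alpha> + \<beta> * (t + T) = a * (1 + \<beta> / a * t)" using a by (simp add: a_def field_simps)
  moreover have "1 + \<beta> / a * t > 0" using a \<beta> t by (intro add_pos_nonneg) auto
  ultimately have "\<rho> (t + T) = a powr (- \<gamma>) * (1 + \<beta> / a * t) powr (- \<gamma>)"
    using eq[of "t + T"] t T a by (simp add: powr_mult)
  moreover have "a powr (1 - \<gamma>) = a * a powr (- \<gamma>)"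
    using a powr_add[of a 1 "- \<gamma>"] by simp
  moreover have "a powr (- \<gamma>) > 0" using a by simp
  ultimately show "shift_density \<rho> T t = scale_density (power_profile \<gamma>) (\<beta> / (\<alpha> + \<beta> * T)) t"
    unfolding shift_density_def I scale_density_def power_profile_def a_def[symmetric]
    using a \<beta> \<gamma> by (simp add: field_simps)
qed

text \<open>Bernoulli's inequality for a negative exponent: (1 + t) powr (-\<gamma>) = exp
  (-\<gamma> ln (1 + t)) \<ge> 1 - \<gamma> ln (1 + t) \<ge> 1 - \<gamma> t. The constant is the
  absolute slope of the profile at 0.\<close>

lemma power_profile_near_0:
  assumes \<gamma>: "\<gamma> > 1" and t: "t \<ge> 0"
  shows "\<bar>power_profile \<gamma> t - (\<gamma> - 1)\<bar> \<le> (\<gamma> - 1) * \<gamma> * t"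
proof -
  have "(1 + t) powr (- \<gamma>) \<le> 1" using t \<gamma> powr_mono[of "- \<gamma>" 0 "1 + t"] by simp
  moreover have "1 - \<gamma> * t \<le> (1 + t) powr (- \<gamma>)"
  proof -
    have "1 - \<gamma> * t \<le> 1 + - \<gamma> * ln (1 + t)"
      using ln_add_one_self_le_self[OF t] \<gamma> by simp
    also have "\<dots> \<le> exp (- \<gamma> * ln (1 + t))" by (rule exp_ge_add_one_self)
    also have "\<dots> = (1 + t) powr (- \<gamma>)" using t by (simp add: powr_def)
    finally show ?thesis .
  qed
  ultimately have "\<bar>(1 + t) powr (- \<gamma>) - 1\<bar> \<le> \<gamma> * t" by linarith
  then have "(\<gamma> - 1) * \<bar>(1 + t) powr (- \<gamma>) - 1\<bar> \<le> (\<gamma> - 1) * (\<gamma> * t)" using \<gamma> by (intro mult_left_mono) auto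
  moreover have "\<bar>power_profile \<gamma> t - (\<gamma> - 1)\<bar> = (\<gamma> - 1) * \<bar>(1 + t) powr (- \<gamma>) - 1\<bar>"
  proof -
    have "power_profile \<gamma> t - (\<gamma> - 1) = (\<gamma> - 1) * ((1 + t) powr (- \<gamma>) - 1)"
      by (simp add: power_profile_def right_diff_distrib)
    then show ?thesis using \<gamma> by (simp add: abs_mult)
  qed
  ultimately show ?thesis by simp
qed

text \<open>Needed for (q) to imply (p): without a witness the universal condition would hold
  vacuously.\<close>

lemma power_density_exists: "\<exists>\<rho>. power_density \<rho>"
proof
  show "power_density (\<lambda>t. (1 + 1 * t) powr (- 2))"
    using powr_tail_has_integral[of 1 1 2 0] unfolding power_density_def prob_density_def
    by (intro conjI exI[of _ "1::real"] exI[of _ "2::real"]) auto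
qed

lemma prob_density_shift:
  assumes \<rho>: "prob_density \<rho>" and T: "T \<ge> 0" and pos: "integral {T..} \<rho> > 0"
  shows "prob_density (shift_density \<rho> T)"
proof -
  note sh = integral_shift_halfline[OF prob_density_absolutely_integrable[OF \<rho>] T]
  have "((\<lambda>t. \<rho> (t + T)) has_integral integral {T..} \<rho>) {0..}"
    using sh by (metis absolutely_integrable_on_def integrable_integral)
  from has_integral_divide[OF this, of "integral {T..} \<rho>"] show ?thesis
    using \<rho> T pos by (simp add: prob_density_def shift_density_def)
qed

text \<open>Keeps the shifts of one density closed under further shifts, so that a single limit in
  \<open>T\<close> controls both a shifted density and its continuation after one more
  block.\<close>

lemma shift_shift_density:
  assumes \<rho>: "prob_density \<rho>" and T: "T \<ge> 0" and S: "S \<ge> 0"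
    and pos: "integral {T..} \<rho> > 0"
  shows "integral {S..} (shift_density \<rho> T) = integral {T + S..} \<rho> / integral {T..} \<rho>"
    and "shift_density (shift_density \<rho> T) S = shift_density \<rho> (T + S)"
proof -
  have "\<rho> absolutely_integrable_on {1 * S + T..}"
    by (rule set_integrable_subset[OF prob_density_absolutely_integrable[OF \<rho>]]) (use T S in auto)
  from integral_affine_halfline(2)[OF this]
  have "integral {S..} (\<lambda>t. \<rho> (t + T)) = integral {T + S..} \<rho>" by (simp add: add.commute)
  then show I: "integral {S..} (shift_density \<rho> T) = integral {T + S..} \<rho> / integral {T..} \<rho>"
    by (simp add: shift_density_def)
  show "shift_density (shift_density \<rho> T) S = shift_density \<rho> (T + S)"
    unfolding shift_density_def[of "shift_density \<rho> T"] I
    using pos by (simp add: shift_density_def add_ac)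
qed

lemma prob_density_shift_power:
  assumes \<rho>: "power_density \<rho>" and T: "T \<ge> 0"
  shows "integral {T..} \<rho> > 0" and "prob_density (shift_density \<rho> T)"
proof -
  obtain \<alpha> \<beta> \<gamma> where \<alpha>: "\<alpha> > 0" and \<beta>: "\<beta> > 0" and pd: "prob_density \<rho>"
    and eq: "\<And>t. t \<ge> 0 \<Longrightarrow> \<rho> t = (\<alpha> + \<beta> * t) powr (- \<gamma>)"
    using \<rho> unfolding power_density_def by blast
  have \<gamma>: "\<gamma> > 1" by (rule power_density_exponent_gt_1[OF pd \<alpha> \<beta> eq])
  have "\<alpha> + \<beta> * T > 0" using \<alpha> \<beta> T by (intro add_pos_nonneg) auto
  then show tail: "integral {T..} \<rho> > 0"
    using power_density_shift(1)[OF \<alpha> \<beta> \<gamma> T eq] \<beta> \<gamma> by simp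
  show "prob_density (shift_density \<rho> T)" by (rule prob_density_shift[OF pd T tail])
qed

section \<open>Approximation by positive step functions\<close>

text \<open>The common width \<open>N\<close> is a natural number so that block boundaries are times
  at which dynamic programming applies; half-open blocks tile [0, m N) without overlap.\<close>

definition step_fun :: "nat \<Rightarrow> (nat \<Rightarrow> real) \<Rightarrow> nat \<Rightarrow> real \<Rightarrow> real" where
  "step_fun N h m t = (\<Sum>i<m. h i * indicator {real (i * N)..<real (Suc i * N)} t)"

lemma step_fun_has_integral: "(step_fun N h m has_integral (real N * (\<Sum>i<m. h i))) {0..}"
proof -
  have "((\<lambda>t. \<Sum>i<m. h i * indicator {real (i * N)..<real (Suc i * N)} t) has_integral
      (\<Sum>i<m. h i * (real (Suc i * N) - real (i * N)))) {0..}"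
    by (intro has_integral_sum has_integral_mult_right has_integral_indicator_halfline) (auto simp: algebra_simps)
  moreover have "(\<Sum>i<m. h i * (real (Suc i * N) - real (i * N))) = real N * (\<Sum>i<m. h i)"
    by (simp add: sum_distrib_left algebra_simps)
  ultimately show ?thesis by (simp add: step_fun_def[abs_def])
qed

lemma step_fun_eq:
  assumes "i < m" "real (i * N) \<le> t" "t < real (Suc i * N)"
  shows "step_fun N h m t = h i"
proof -
  have uniq: "j = i" if "real (j * N) \<le> t" "t < real (Suc j * N)" for j
  proof -
    have "real (i * N) < real (Suc j * N)" "real (j * N) < real (Suc i * N)" using assms that by linarith+
    then have "i * N < Suc j * N" "j * N < Suc i * N" unfolding of_nat_less_iff by auto
    then have "i < Suc j" "j < Suc i" by (simp_all only: mult_less_cancel2)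
    then show ?thesis by simp
  qed
  have "indicator {real (j * N)..<real (Suc j * N)} t = (if j = i then 1 else 0 :: real)" for j
    using uniq[of j] assms(2,3) by (simp only: indicator_simps atLeastLessThan_iff split: if_split) (metis indicator_simps atLeastLessThan_iff)
  then have "step_fun N h m t = (\<Sum>j<m. h j * (if j = i then 1 else 0))"
    unfolding step_fun_def by simp
  also have "\<dots> = (\<Sum>j<m. if j = i then h i else 0)" by (rule sum.cong) auto
  finally have "step_fun N h m t = (\<Sum>j<m. if j = i then h i else 0)" .
  then show ?thesis using assms by simp
qed

lemma step_fun_eq_0:
  assumes "real (m * N) \<le> t"
  shows "step_fun N h m t = 0"
  unfolding step_fun_def
proof (intro sum.neutral ballI)
  fix i assume "i \<in> {..<m}"
  then have "real (Suc i * N) \<le> real (m * N)" by (intro of_nat_mono mult_right_mono) auto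
  then show "h i * indicator {real (i * N)..<real (Suc i * N)} t = 0" using assms by (auto simp: indicator_def)
qed

lemma step_fun_nonneg:
  assumes "\<And>i. i < m \<Longrightarrow> 0 \<le> h i"
  shows "0 \<le> step_fun N h m t"
  unfolding step_fun_def using assms by (intro sum_nonneg mult_nonneg_nonneg) auto

lemma step_fun_shift:
  assumes "0 \<le> t"
  shows "step_fun N h (Suc m) (t + real N) = step_fun N (\<lambda>i. h (Suc i)) m t"
proof -
  have "indicator {real (Suc i * N)..<real (Suc (Suc i) * N)} (t + real N)
      = (indicator {real (i * N)..<real (Suc i * N)} t :: real)" for i
    by (simp add: indicator_def)
  moreover have "(indicator {real (0 * N)..<real (Suc 0 * N)} (t + real N) :: real) = 0"
    using assms by (simp add: indicator_def)
  ultimately show ?thesis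
    unfolding step_fun_def sum.lessThan_Suc_shift by (simp only: mult_zero_right add_0)
qed

text \<open>The quantifier order is the point. The number of steps \<open>m\<close> and the ratio of
  the height bounds depend on \<mu> and \<eta> only; the required width \<open>Q\<close> may be
  chosen later, in terms of \<open>m\<close>, \<kappa> and \<open>C\<close>. This is possible
  because the steps are cut in scaled time s = l t, where the picture does not change, while their
  width in real time grows like 1 / l.\<close>

lemma positive_step_approximation:
  assumes \<mu>: "prob_density \<mu>" and \<eta>: "\<eta> > 0"
  obtains m \<kappa> C where "m \<ge> (1::nat)" "\<kappa> > (0::real)" "C > (0::real)"
    "\<And>Q. eventually (\<lambda>l. \<exists>N h. real N \<ge> Q \<and> (\<forall>i<m. l * \<kappa> \<le> h i \<and> h i \<le> l * C) \<and>
       integral {0..} (\<lambda>t. \<bar>scale_density \<mu> l t - step_fun N h m t\<bar>) \<le> \<eta>) (at_right 0)"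
proof -
  \<comment> \<open>Five shares: two for replacing \<mu> by \<psi>, one for the oscillation of
    \<psi> within a step, one for the tail beyond \<open>B\<close>, one for the gap left by rounding
    \<open>N\<close>.\<close>
  define \<zeta> where "\<zeta> = \<eta> / 5"
  have \<zeta>: "\<zeta> > 0" using \<eta> by (simp add: \<zeta>_def)
  have \<mu>i: "\<mu> absolutely_integrable_on {0..}" by (rule prob_density_absolutely_integrable[OF \<mu>])
  have \<mu>0: "\<mu> t \<ge> 0" if "t \<ge> 0" for t using \<mu> that by (simp add: prob_density_def)
  have "eventually (\<lambda>B. integral {B..} \<mu> < \<zeta>) at_top"
    using integral_tail_tendsto_0[OF \<mu>i] \<zeta> by (intro order_tendstoD(2)) auto
  then have "eventually (\<lambda>B. B > 0 \<and> integral {B..} \<mu> < \<zeta>) at_top"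
    using eventually_gt_at_top[of 0] by eventually_elim auto
  then obtain B where B: "B > 0" and tail: "integral {B..} \<mu> < \<zeta>"
    using eventually_happens'[OF trivial_limit_at_top_linorder] by blast
  have \<mu>B: "\<mu> absolutely_integrable_on {0..B}" by (rule set_integrable_subset[OF \<mu>i]) auto
  obtain \<phi> where \<phi>: "continuous_on UNIV \<phi>" "\<And>t. 0 \<le> \<phi> t" "integral {0..B} (\<lambda>t. \<bar>\<mu> t - \<phi> t\<bar>) < \<zeta>"
    using continuous_L1_approximation[OF \<mu>B _ \<zeta>] \<mu>0 by auto
  \<comment> \<open>Raising \<phi> by \<kappa> makes all heights positive and costs \<kappa> B =
    \<zeta>. The same \<kappa> serves as tolerance for the uniform continuity of \<psi>.\<close>
  define \<kappa> where "\<kappa> = \<zeta> / B"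
  have \<kappa>: "\<kappa> > 0" using \<zeta> B by (simp add: \<kappa>_def)
  define \<psi> where "\<psi> t = \<phi> t + \<kappa>" for t
  have \<psi>c: "continuous_on {0..B} \<psi>" unfolding \<psi>_def by (intro continuous_intros continuous_on_subset[OF \<phi>(1)]) auto
  have \<psi>i: "\<psi> absolutely_integrable_on {0..B}" by (rule absolutely_integrable_continuous_real[OF \<psi>c])
  have \<psi>\<kappa>: "\<kappa> \<le> \<psi> t" for t using \<phi>(2) by (simp add: \<psi>_def)
  have "bounded (\<psi> ` {0..B})" by (rule compact_imp_bounded[OF compact_continuous_image[OF \<psi>c]]) simp
  then obtain C where C: "C > 0" "\<And>t. t \<in> {0..B} \<Longrightarrow> \<psi> t \<le> C"
    unfolding bounded_pos by (force simp: abs_le_iff)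
  have "uniformly_continuous_on {0..B} \<psi>" by (rule compact_uniformly_continuous[OF \<psi>c]) simp
  then obtain \<delta> where \<delta>: "\<delta> > 0" "\<And>s t. s \<in> {0..B} \<Longrightarrow> t \<in> {0..B} \<Longrightarrow> \<bar>s - t\<bar> < \<delta> \<Longrightarrow> \<bar>\<psi> s - \<psi> t\<bar> < \<kappa>"
    unfolding uniformly_continuous_on_def dist_real_def using \<kappa> by metis
  obtain m :: nat where m: "real m > max 1 (B / \<delta>)" using reals_Archimedean2 by blast
  then have m1: "m \<ge> 1" "B / real m < \<delta>" using \<delta> by (auto simp: field_simps)
  have \<mu>\<psi>i: "(\<lambda>t. \<bar>\<mu> t - \<psi> t\<bar>) integrable_on {0..B}"
    using set_integrable_abs[OF set_integral_diff(1)[OF \<mu>B \<psi>i]] by (simp add: absolutely_integrable_on_def)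
  have \<mu>\<phi>i: "(\<lambda>t. \<bar>\<mu> t - \<phi> t\<bar>) integrable_on {0..B}"
  proof -
    have "\<phi> absolutely_integrable_on {0..B}"
      by (rule absolutely_integrable_continuous_real) (rule continuous_on_subset[OF \<phi>(1)], simp)
    from set_integrable_abs[OF set_integral_diff(1)[OF \<mu>B this]] show ?thesis
      by (simp add: absolutely_integrable_on_def)
  qed
  have "integral {0..B} (\<lambda>t. \<bar>\<mu> t - \<psi> t\<bar>) \<le> integral {0..B} (\<lambda>t. \<bar>\<mu> t - \<phi> t\<bar> + \<kappa>)"
    using \<kappa> by (intro integral_le \<mu>\<psi>i integrable_add \<mu>\<phi>i) (auto simp: \<psi>_def)
  also have "\<dots> = integral {0..B} (\<lambda>t. \<bar>\<mu> t - \<phi> t\<bar>) + \<kappa> * B"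
    using B by (subst integral_add[OF \<mu>\<phi>i]) auto
  also have "\<dots> < 2 * \<zeta>" using \<phi>(3) B by (simp add: \<kappa>_def)
  finally have I1: "integral {0..B} (\<lambda>t. \<bar>\<mu> t - \<psi> t\<bar>) < 2 * \<zeta>" .

  have key: "\<exists>N h. real N \<ge> Q \<and> (\<forall>i<m. l * \<kappa> \<le> h i \<and> h i \<le> l * C) \<and>
       integral {0..} (\<lambda>t. \<bar>scale_density \<mu> l t - step_fun N h m t\<bar>) \<le> \<eta>"
    if l: "l > 0" "l < B / (real m * (2 + \<bar>Q\<bar>))" "l < \<zeta> / (C * real m)" for l Q
  proof -
    \<comment> \<open>Rounded down, the \<open>m\<close> blocks cover [0, c] in scaled time, missing
      at most m l of [0, B]. The second bound on \<open>l\<close> makes \<open>N\<close> exceed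
      \<open>Q\<close> and 1, the third makes C (B - c) at most \<zeta>.\<close>
    define N where "N = nat \<lfloor>B / (real m * l)\<rfloor>"
    have ml: "real m * l > 0" using m1 l by simp
    have big: "B / (real m * l) > 2 + \<bar>Q\<bar>"
    proof -
      have "l * (real m * (2 + \<bar>Q\<bar>)) < B"
        using l(2) m1 by (subst (asm) pos_less_divide_eq) auto
      then show ?thesis using ml by (subst pos_less_divide_eq) (auto simp: mult_ac)
    qed
    have N1: "real N \<le> B / (real m * l)" "B / (real m * l) < real N + 1"
      using B ml by (auto simp: N_def)
    have NQ: "real N \<ge> Q" "real N \<ge> 1" using N1 big by linarith+
    define c where "c = real m * real N * l"
    have c: "0 \<le> c" "c \<le> B" "B - c \<le> real m * l"
      using N1 ml l(1) by (auto simp: c_def field_simps)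
    have lN: "l * real N < \<delta>"
    proof -
      have "l * real N \<le> B / real m" using c(2) m1 by (simp add: c_def field_simps)
      then show ?thesis using m1(2) by simp
    qed
    define h where "h i = l * \<psi> (l * real (i * N))" for i
    have in0B: "l * real (i * N) \<in> {0..B}" if "i < m" for i
    proof -
      have "real (i * N) \<le> real (m * N)" using that by (intro of_nat_mono mult_right_mono) auto
      then have "l * real (i * N) \<le> l * real (m * N)" using l(1) by (intro mult_left_mono) auto
      moreover have "l * real (m * N) = c" by (simp add: c_def)
      ultimately have "l * real (i * N) \<le> B" using c(2) by linarith
      then show ?thesis using l(1) by simp
    qed
    have hb: "\<forall>i<m. l * \<kappa> \<le> h i \<and> h i \<le> l * C"
      using in0B C(2) \<psi>\<kappa> l(1) unfolding h_def by (auto intro!: mult_left_mono)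
    have h0: "0 \<le> h i" for i
      unfolding h_def using l(1) \<kappa> \<psi>\<kappa>[of "l * real (i * N)"] by (intro mult_nonneg_nonneg) auto
    \<comment> \<open>A pointwise majorant of the error in scaled time. In the gap [c, B] the step
      function vanishes, and there \<mu> \<le> \<bar>\<mu> - \<psi>\<bar> + C, which explains the
      last summand.\<close>
    define D where "D s = (if s \<in> {0..B} then \<bar>\<mu> s - \<psi> s\<bar> + \<kappa> else 0) + (if s \<in> {B..} then \<mu> s else 0)
        + C * indicator {c..B} s" for s
    have "((\<lambda>s. \<bar>\<mu> s - \<psi> s\<bar> + \<kappa>) has_integral (integral {0..B} (\<lambda>t. \<bar>\<mu> t - \<psi> t\<bar>) + \<kappa> * B)) {0..B}"
      using has_integral_const_real[of \<kappa> 0 B] B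
      by (intro has_integral_add integrable_integral[OF \<mu>\<psi>i]) (auto simp: mult.commute)
    then have D1: "((\<lambda>s. if s \<in> {0..B} then \<bar>\<mu> s - \<psi> s\<bar> + \<kappa> else 0) has_integral
        (integral {0..B} (\<lambda>t. \<bar>\<mu> t - \<psi> t\<bar>) + \<kappa> * B)) {0..}"
      by (subst has_integral_restrict) auto
    have "\<mu> integrable_on {B..}"
      using set_integrable_subset[OF \<mu>i, of "{B..}"] B by (simp add: absolutely_integrable_on_def)
    then have D2: "((\<lambda>s. if s \<in> {B..} then \<mu> s else 0) has_integral integral {B..} \<mu>) {0..}"
      using B by (subst has_integral_restrict) (auto intro: integrable_integral)
    have D3: "((\<lambda>s. C * indicator {c..B} s) has_integral C * (B - c)) {0..}"
      by (intro has_integral_mult_right has_integral_indicator_halfline) (use c in \<open>auto simp: subset_iff\<close>)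
    have DI: "(D has_integral (integral {0..B} (\<lambda>t. \<bar>\<mu> t - \<psi> t\<bar>) + \<kappa> * B) + integral {B..} \<mu> + C * (B - c)) {0..}"
      unfolding D_def by (intro has_integral_add D1 D2 D3)
    have D0: "0 \<le> D s" if "s \<ge> 0" for s
      using \<kappa> C(1) \<mu>0[OF that] by (auto simp: D_def indicator_def)
    have Dabs: "D absolutely_integrable_on {0..}" using DI D0 by (rule has_integral_nonneg_absolutely) auto
    have "C * (B - c) \<le> C * (real m * l)" using c C by (intro mult_left_mono) auto
    also have "\<dots> \<le> \<zeta>" using l(3) C m1 by (simp add: field_simps)
    finally have "C * (B - c) \<le> \<zeta>" .
    moreover have "\<kappa> * B = \<zeta>" using B by (simp add: \<kappa>_def)
    ultimately have intD: "integral {0..} D \<le> \<eta>"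
      using I1 tail by (simp add: integral_unique[OF DI] \<zeta>_def)
    have pw: "\<bar>scale_density \<mu> l t - step_fun N h m t\<bar> \<le> l * D (l * t)" if t: "t \<ge> 0" for t
    proof -
      let ?s = "l * t"
      have s0: "?s \<ge> 0" using t l(1) by simp
      have "\<bar>\<mu> ?s - step_fun N h m t / l\<bar> \<le> D ?s"
      proof (cases "t < real (m * N)")
        case True
        define i where "i = nat \<lfloor>t / real N\<rfloor>"
        have N0: "real N > 0" using NQ by simp
        have i: "real i \<le> t / real N" "t / real N < real i + 1"
          using t N0 by (auto simp: i_def)
        then have i': "real (i * N) \<le> t" "t < real (Suc i * N)"
          using N0 by (auto simp: field_simps)
        then have "real (i * N) < real (m * N)" using True by linarith
        then have im: "i < m" unfolding of_nat_less_iff by (simp only: mult_less_cancel2)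
        have val: "step_fun N h m t / l = \<psi> (l * real (i * N))"
          using step_fun_eq[OF im i', of h] l(1) by (simp add: h_def)
        have "?s \<le> l * real (m * N)" using True l(1) by (intro mult_left_mono) auto
        then have sB: "?s \<in> {0..B}" using s0 c(2) by (auto simp: c_def mult_ac)
        have "t - real (i * N) \<le> real N" "0 \<le> t - real (i * N)" using i' by (auto simp: algebra_simps)
        then have "l * (t - real (i * N)) \<le> l * real N" "0 \<le> l * (t - real (i * N))" using l(1) by auto
        then have "\<bar>?s - l * real (i * N)\<bar> < \<delta>" using lN by (simp add: right_diff_distrib)
        then have "\<bar>\<psi> ?s - \<psi> (l * real (i * N))\<bar> < \<kappa>" using \<delta>(2)[OF sB in0B[OF im]] by simp
        then have "\<bar>\<mu> ?s - step_fun N h m t / l\<bar> \<le> \<bar>\<mu> ?s - \<psi> ?s\<bar> + \<kappa>" unfolding val by linarith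
        also have "\<dots> \<le> D ?s" using sB \<mu>0[OF s0] C(1) by (simp add: D_def indicator_def)
        finally show ?thesis .
      next
        case False
        then have st: "step_fun N h m t = 0" by (intro step_fun_eq_0) simp
        have "c \<le> ?s" using False l(1) mult_left_mono[of "real (m * N)" t l] by (auto simp: c_def mult_ac)
        have "\<mu> ?s \<le> D ?s"
        proof (cases "?s \<le> B")
          case True
          then have "D ?s \<ge> \<bar>\<mu> ?s - \<psi> ?s\<bar> + \<kappa> + C"
            using \<open>c \<le> ?s\<close> s0 \<mu>0[OF s0] by (simp add: D_def)
          moreover have "\<psi> ?s \<le> C" using True s0 by (intro C(2)) simp
          ultimately show ?thesis using \<kappa> by linarith
        next
          case False
          then show ?thesis by (simp add: D_def)
        qed
        then show ?thesis using st \<mu>0[OF s0] by simp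
      qed
      then have "l * \<bar>\<mu> ?s - step_fun N h m t / l\<bar> \<le> l * D ?s" using l(1) by (intro mult_left_mono) auto
      moreover have "l * \<bar>\<mu> ?s - step_fun N h m t / l\<bar> = \<bar>l * (\<mu> ?s - step_fun N h m t / l)\<bar>"
        using l(1) by (simp add: abs_mult)
      moreover have "l * (\<mu> ?s - step_fun N h m t / l) = scale_density \<mu> l t - step_fun N h m t"
        using l(1) by (simp add: scale_density_def right_diff_distrib)
      ultimately show ?thesis by simp
    qed
    have sabs: "scale_density \<mu> l absolutely_integrable_on {0..}"
      by (rule prob_density_absolutely_integrable[OF prob_density_scale[OF \<mu> l(1)]])
    have stabs: "step_fun N h m absolutely_integrable_on {0..}"
      using step_fun_has_integral by (rule has_integral_nonneg_absolutely) (use h0 step_fun_nonneg in auto)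
    have Dl: "(\<lambda>t. D (l * t)) absolutely_integrable_on {0..}" "integral {0..} (\<lambda>t. D (l * t)) = integral {0..} D / l"
      using integral_affine_halfline[where f = D and l = l and a = 0 and b = 0] Dabs l(1) by simp_all
    have "integral {0..} (\<lambda>t. \<bar>scale_density \<mu> l t - step_fun N h m t\<bar>) \<le> integral {0..} (\<lambda>t. l * D (l * t))"
    proof (rule integral_le)
      show "(\<lambda>t. \<bar>scale_density \<mu> l t - step_fun N h m t\<bar>) integrable_on {0..}"
        using set_integrable_abs[OF set_integral_diff(1)[OF sabs stabs]] by (simp add: absolutely_integrable_on_def)
      show "(\<lambda>t. l * D (l * t)) integrable_on {0..}"
        using Dl(1) by (intro integrable_on_mult_right) (simp add: absolutely_integrable_on_def)
    qed (use pw in auto)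
    also have "\<dots> = integral {0..} D" using Dl(2) l(1) by simp
    finally show ?thesis using NQ hb intD by (intro exI[of _ N] exI[of _ h]) auto
  qed
  show thesis
  proof (rule that[OF m1(1) \<kappa> C(1)])
    fix Q :: real
    let ?l0 = "min (B / (real m * (2 + \<bar>Q\<bar>))) (\<zeta> / (C * real m))"
    have "?l0 > 0" using B m1 \<zeta> C(1) by (auto intro!: divide_pos_pos mult_pos_pos)
    then have "eventually (\<lambda>l. l \<in> {0<..<?l0}) (at_right 0)" by (rule eventually_at_right_real)
    then show "eventually (\<lambda>l. \<exists>N h. real N \<ge> Q \<and> (\<forall>i<m. l * \<kappa> \<le> h i \<and> h i \<le> l * C) \<and>
       integral {0..} (\<lambda>t. \<bar>scale_density \<mu> l t - step_fun N h m t\<bar>) \<le> \<eta>) (at_right 0)"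
      by eventually_elim (rule key, auto)
  qed
qed

section \<open>Values of densities\<close>

locale tauberian_game =
  fixes K :: "(real \<Rightarrow> 'w) set"
    and g :: "'w \<Rightarrow> real"
    and V :: "((real \<Rightarrow> 'w) \<Rightarrow> real) \<Rightarrow> 'w \<Rightarrow> real"
  assumes g_range: "\<And>\<omega>. 0 \<le> g \<omega> \<and> g \<omega> \<le> 1"
    and g_meas: "\<And>z. z \<in> K \<Longrightarrow> set_borel_measurable lebesgue {0..} (\<lambda>t. g (z t))"
    and game: "game_mapping K V"
    and dpp: "discrete_DPP g V"
begin

abbreviation "W \<equiv> Val g V"

section \<open>Consequences of the axioms of a game mapping\<close>

lemma V_affine:
  assumes "bounded (c ` K)" "A \<ge> 0"
  shows "V (\<lambda>z. A * c z + B) \<omega> = A * V c \<omega> + B"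
proof -
  have "\<forall>c (A::real) B. bounded (c ` K) \<and> A \<ge> 0 \<longrightarrow> V (\<lambda>z. A * c z + B) = (\<lambda>\<omega>. A * V c \<omega> + B)"
    using game unfolding game_mapping_def by (elim conjE)
  from this[rule_format, of c A B] assms show ?thesis by simp
qed

lemma V_mono:
  assumes "bounded (c1 ` K)" "bounded (c2 ` K)" "\<And>z. z \<in> K \<Longrightarrow> c1 z \<le> c2 z"
  shows "V c1 \<omega> \<le> V c2 \<omega>"
proof -
  have "\<forall>c1 c2. bounded (c1 ` K) \<and> bounded (c2 ` K) \<and> (\<forall>z\<in>K. c1 z \<le> c2 z) \<longrightarrow> (\<forall>\<omega>. V c1 \<omega> \<le> V c2 \<omega>)"
    using game unfolding game_mapping_def by (elim conjE)
  from this[rule_format, of c1 c2 \<omega>] assms show ?thesis by simp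
qed

text \<open>Monotonicity applied to c1 \<le> c2 + d and to c2 \<le> c1 + d, with the constant pulled
  out of \<open>V\<close>.\<close>

lemma V_nonexpansive:
  assumes "bounded (c1 ` K)" "bounded (c2 ` K)" "\<And>z. z \<in> K \<Longrightarrow> \<bar>c1 z - c2 z\<bar> \<le> d"
  shows "\<bar>V c1 \<omega> - V c2 \<omega>\<bar> \<le> d"
proof -
  have *: "V a \<omega> \<le> V b \<omega> + d"
    if a: "bounded (a ` K)" and b: "bounded (b ` K)" and ab: "\<And>z. z \<in> K \<Longrightarrow> \<bar>a z - b z\<bar> \<le> d" for a b
  proof -
    have "bounded ((\<lambda>x. x + d) ` (b ` K))"
      using bounded_translation[OF b, of d] by (simp add: add.commute)
    then have "bounded ((\<lambda>z. b z + d) ` K)" by (simp add: image_image)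
    then have "V a \<omega> \<le> V (\<lambda>z. b z + d) \<omega>"
      using ab by (intro V_mono a) (auto simp: abs_le_iff algebra_simps)
    then show ?thesis using V_affine[OF b, of 1 d \<omega>] by simp
  qed
  show ?thesis using *[of c1 c2] *[of c2 c1] assms by (auto simp: abs_minus_commute abs_le_iff)
qed

lemma gz_measurable:
  assumes z: "z \<in> K" and S: "S \<subseteq> {0..}" "S \<in> sets lebesgue"
  shows "(\<lambda>t. g (z t)) \<in> borel_measurable (lebesgue_on S)"
proof -
  have "(\<lambda>t. indicator S t *\<^sub>R (indicator {0..} t *\<^sub>R g (z t))) \<in> borel_measurable lebesgue"
    using g_meas[OF z, unfolded set_borel_measurable_def] S(2)
    by (rule borel_measurable_scaleR[OF borel_measurable_indicator, rotated])
  also have "(\<lambda>t. indicator S t *\<^sub>R (indicator {0..} t *\<^sub>R g (z t))) = (\<lambda>t. if t \<in> S then g (z t) else 0)"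
    using S(1) by (intro ext) (auto simp: indicator_def subset_iff)
  finally show ?thesis using S(2) by (simp add: borel_measurable_if)
qed

lemma weighted_integrable:
  assumes "z \<in> K" "S \<subseteq> {0..}" "S \<in> sets lebesgue" "\<rho> absolutely_integrable_on S"
  shows "(\<lambda>t. \<rho> t * g (z t)) absolutely_integrable_on S"
proof -
  have "bounded ((\<lambda>t. g (z t)) ` S)"
    using g_range by (auto intro!: boundedI[of _ 1])
  then have "(\<lambda>t. g (z t) * \<rho> t) absolutely_integrable_on S"
    using assms by (intro absolutely_integrable_bounded_measurable_product_real gz_measurable)
  then show ?thesis by (simp add: mult.commute)
qed

lemma weighted_diff:
  assumes z: "z \<in> K" and S: "S \<subseteq> {0..}" "S \<in> sets lebesgue"
    and \<rho>: "\<rho> absolutely_integrable_on S" and \<sigma>: "\<sigma> absolutely_integrable_on S"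
  shows "\<bar>integral S (\<lambda>t. \<rho> t * g (z t)) - integral S (\<lambda>t. \<sigma> t * g (z t))\<bar>
       \<le> integral S (\<lambda>t. \<bar>\<rho> t - \<sigma> t\<bar>)"
proof -
  note i = weighted_integrable[OF z S \<rho>] weighted_integrable[OF z S \<sigma>]
  have d: "(\<lambda>t. \<rho> t - \<sigma> t) absolutely_integrable_on S" using \<rho> \<sigma> by (rule set_integral_diff(1))
  have "integral S (\<lambda>t. \<rho> t * g (z t)) - integral S (\<lambda>t. \<sigma> t * g (z t))
      = integral S (\<lambda>t. (\<rho> t - \<sigma> t) * g (z t))"
    using i by (simp add: absolutely_integrable_on_def integral_diff[symmetric] algebra_simps)
  moreover have "norm (integral S (\<lambda>t. (\<rho> t - \<sigma> t) * g (z t))) \<le> integral S (\<lambda>t. \<bar>\<rho> t - \<sigma> t\<bar>)"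
  proof (rule integral_norm_bound_integral)
    show "(\<lambda>t. (\<rho> t - \<sigma> t) * g (z t)) integrable_on S"
      using weighted_integrable[OF z S d] by (simp add: absolutely_integrable_on_def)
    show "(\<lambda>t. \<bar>\<rho> t - \<sigma> t\<bar>) integrable_on S"
      using d by (simp add: absolutely_integrable_on_def)
    show "norm ((\<rho> t - \<sigma> t) * g (z t)) \<le> \<bar>\<rho> t - \<sigma> t\<bar>" for t
      using g_range by (simp add: abs_mult mult_left_le)
  qed
  ultimately show ?thesis by simp
qed

lemma weighted_bound:
  assumes "z \<in> K" "S \<subseteq> {0..}" "S \<in> sets lebesgue" "\<rho> absolutely_integrable_on S"
  shows "\<bar>integral S (\<lambda>t. \<rho> t * g (z t))\<bar> \<le> integral S (\<lambda>t. \<bar>\<rho> t\<bar>)"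
  using weighted_diff[OF assms, of "\<lambda>_. 0"] by simp

lemma bounded_weighted:
  assumes "S \<subseteq> {0..}" "S \<in> sets lebesgue" "\<rho> absolutely_integrable_on S"
  shows "bounded ((\<lambda>z. integral S (\<lambda>t. \<rho> t * g (z t))) ` K)"
  by (rule boundedI) (use weighted_bound[OF _ assms] in \<open>auto simp: image_iff\<close>)

lemma bounded_cost: "\<rho> absolutely_integrable_on {0..} \<Longrightarrow> bounded (cost g \<rho> ` K)"
  using bounded_weighted[of "{0..}" \<rho>] unfolding cost_def by simp

lemma bounded_W:
  assumes "\<rho> absolutely_integrable_on {0..}"
  shows "bounded (range (W \<rho>))"
proof -
  have "\<forall>c. bounded (c ` K) \<longrightarrow> bounded (range (V c))"
    using game unfolding game_mapping_def by (elim conjE)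
  from this[rule_format, OF bounded_cost[OF assms]] show ?thesis by (simp add: Val_def)
qed

lemma W_diff:
  assumes "\<rho> absolutely_integrable_on {0..}" "\<sigma> absolutely_integrable_on {0..}"
  shows "\<bar>W \<rho> \<omega> - W \<sigma> \<omega>\<bar> \<le> integral {0..} (\<lambda>t. \<bar>\<rho> t - \<sigma> t\<bar>)"
  unfolding Val_def using assms weighted_diff[of _ "{0..}" \<rho> \<sigma>]
  by (intro V_nonexpansive bounded_cost) (auto simp: cost_def)

lemma cost_cong:
  assumes "\<And>t. t \<ge> 0 \<Longrightarrow> \<rho> t = \<sigma> t"
  shows "cost g \<rho> = cost g \<sigma>"
  unfolding cost_def using assms by (intro ext integral_cong) auto

lemma W_cong:
  assumes "\<And>t. t \<ge> 0 \<Longrightarrow> \<rho> t = \<sigma> t"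
  shows "W \<rho> = W \<sigma>"
  unfolding Val_def using cost_cong[OF assms] by simp

lemma W_scale:
  assumes "\<rho> absolutely_integrable_on {0..}" "A \<ge> 0"
  shows "W (\<lambda>t. A * \<rho> t) \<omega> = A * W \<rho> \<omega>"
proof -
  have "cost g (\<lambda>t. A * \<rho> t) = (\<lambda>z. A * cost g \<rho> z + 0)"
    by (auto simp: cost_def mult.assoc)
  then show ?thesis using V_affine[OF bounded_cost, of \<rho> A 0 \<omega>] assms by (simp add: Val_def)
qed

lemma W_zero: "W (\<lambda>t. 0) \<omega> = 0"
  using W_scale[of "\<lambda>_. 0" 0] by simp

text \<open>Frees dynamic programming from normalisation, so that indicators and step functions can
  be used as they are. Dividing by the total mass gives a probability density; homogeneity undoes
  this, and the tail weight cancels against the normalisation of the shifted density.\<close>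

lemma W_DPP:
  assumes \<rho>: "\<rho> absolutely_integrable_on {0..}" and nonneg: "\<And>t. t \<ge> 0 \<Longrightarrow> \<rho> t \<ge> 0"
    and n: "n \<ge> 1" and pos: "integral {real n..} \<rho> > 0"
  shows "W \<rho> \<omega> = V (\<lambda>z. integral {0..real n} (\<lambda>t. \<rho> t * g (z t)) + W (\<lambda>t. \<rho> (t + real n)) (z (real n))) \<omega>"
proof -
  define m where "m = integral {0..} \<rho>"
  define R where "R = integral {real n..} \<rho>"
  have R: "R > 0" using pos by (simp add: R_def)
  have \<rho>n: "\<rho> absolutely_integrable_on {0..real n}" by (rule set_integrable_subset[OF \<rho>]) auto
  have "0 \<le> integral {0..real n} \<rho>"
    using nonneg \<rho>n by (intro integral_nonneg) (auto simp: absolutely_integrable_on_def)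
  then have m: "m > 0"
    using integral_halfline_split[OF \<rho>, of "real n"] R by (simp add: m_def R_def)
  have \<rho>i: "\<rho> integrable_on {0..}" using \<rho> by (simp add: absolutely_integrable_on_def)
  define \<rho>' where "\<rho>' t = \<rho> t / m" for t
  have "prob_density \<rho>'"
    unfolding prob_density_def \<rho>'_def
    using nonneg m has_integral_divide[OF integrable_integral[OF \<rho>i], of m] by (auto simp: m_def)
  moreover have tail: "integral {real n..} \<rho>' = R / m" unfolding \<rho>'_def R_def by simp
  ultimately have V1: "V (dcost g V \<rho>' (real n)) = W \<rho>'"
    using dpp[unfolded discrete_DPP_def, rule_format, of \<rho>' n] n R m unfolding Val_def by (metis divide_pos_pos)
  have W\<rho>: "W \<rho>' \<omega> = W \<rho> \<omega> / m"
    using W_scale[OF \<rho>, of "1 / m" \<omega>] m by (simp add: \<rho>'_def[abs_def])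
  have sh: "(\<lambda>t. \<rho> (t + real n)) absolutely_integrable_on {0..}"
    by (rule integral_shift_halfline(1)[OF \<rho>]) simp
  have "shift_density \<rho>' (real n) = (\<lambda>t. (1 / R) * \<rho> (t + real n))"
    using m R tail by (auto simp: shift_density_def \<rho>'_def)
  then have W\<sigma>: "V (cost g (shift_density \<rho>' (real n))) \<omega>' = W (\<lambda>t. \<rho> (t + real n)) \<omega>' / R" for \<omega>'
    using W_scale[OF sh, of "1 / R" \<omega>'] R by (simp add: Val_def)
  define c where "c z = integral {0..real n} (\<lambda>t. \<rho> t * g (z t)) + W (\<lambda>t. \<rho> (t + real n)) (z (real n))" for z
  have "dcost g V \<rho>' (real n) z = (1 / m) * c z + 0" for z
  proof -
    have "integral {0..real n} (\<lambda>t. \<rho>' t * g (z t)) = integral {0..real n} (\<lambda>t. \<rho> t * g (z t)) / m"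
      by (simp add: \<rho>'_def)
    then show ?thesis
      unfolding dcost_def W\<sigma> tail c_def using R m by (simp add: add_divide_distrib)
  qed
  then have "dcost g V \<rho>' (real n) = (\<lambda>z. (1 / m) * c z + 0)" by blast
  moreover have "bounded (c ` K)"
  proof -
    have "bounded ((\<lambda>z. integral {0..real n} (\<lambda>t. \<rho> t * g (z t))) ` K)"
      by (rule bounded_weighted[OF _ _ \<rho>n]) auto
    moreover have "bounded ((\<lambda>z. W (\<lambda>t. \<rho> (t + real n)) (z (real n))) ` K)"
      by (rule bounded_subset[OF bounded_W[OF sh]]) auto
    ultimately show ?thesis unfolding c_def by (rule bounded_plus_comp)
  qed
  ultimately have "W \<rho>' \<omega> = (1 / m) * V c \<omega>"
    using V_affine[of c "1 / m" 0 \<omega>] V1 m by simp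
  then show ?thesis using W\<rho> m unfolding c_def[abs_def] by simp
qed

text \<open>The \<open>F n f\<close> of the overview is \<open>block 1 n f\<close>; the factor
  \<open>h\<close> is the height of a density that is constant on [0, n].\<close>

definition block :: "real \<Rightarrow> nat \<Rightarrow> ('w \<Rightarrow> real) \<Rightarrow> 'w \<Rightarrow> real" where
  "block h n f = V (\<lambda>z. h * integral {0..real n} (\<lambda>t. g (z t)) + f (z (real n)))"

lemma bounded_block_payoff:
  assumes "bounded (range f)"
  shows "bounded ((\<lambda>z. h * integral {0..real n} (\<lambda>t. g (z t)) + f (z (real n))) ` K)"
proof (rule bounded_plus_comp)
  have "bounded ((\<lambda>z. integral {0..real n} (\<lambda>t. h * g (z t))) ` K)"
    by (rule bounded_weighted) (auto simp: absolutely_integrable_on_const)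
  then show "bounded ((\<lambda>z. h * integral {0..real n} (\<lambda>t. g (z t))) ` K)" by simp
  show "bounded ((\<lambda>z. f (z (real n))) ` K)"
    by (rule bounded_subset[OF assms]) auto
qed

lemma block_diff:
  assumes "bounded (range f1)" "bounded (range f2)" "\<And>\<omega>. \<bar>f1 \<omega> - f2 \<omega>\<bar> \<le> d"
  shows "\<bar>block h n f1 \<omega> - block h n f2 \<omega>\<bar> \<le> d"
  unfolding block_def using assms by (intro V_nonexpansive bounded_block_payoff) auto

text \<open>Reduces a block of height \<open>h\<close> with terminal payoff R U to a unit block with
  r = R / h.\<close>

lemma block_scale:
  assumes "bounded (range f)" "A \<ge> 0"
  shows "block (A * h) n (\<lambda>\<omega>. A * f \<omega>) \<omega> = A * block h n f \<omega>"
  using V_affine[OF bounded_block_payoff[OF assms(1)] assms(2), of h n 0 \<omega>]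
  unfolding block_def by (simp add: distrib_left mult.assoc)

text \<open>The common source of all block estimates: by dynamic programming both sides are values
  of payoffs on [0, n], whose running parts differ by at most \<open>d\<close> and terminal parts by
  at most \<open>e\<close>.\<close>

lemma W_block:
  assumes \<rho>: "\<rho> absolutely_integrable_on {0..}" and nonneg: "\<And>t. t \<ge> 0 \<Longrightarrow> \<rho> t \<ge> 0"
    and n: "n \<ge> 1" and pos: "integral {real n..} \<rho> > 0"
    and f: "bounded (range f)" and e: "\<And>\<omega>. \<bar>W (\<lambda>t. \<rho> (t + real n)) \<omega> - f \<omega>\<bar> \<le> e"
    and d: "integral {0..real n} (\<lambda>t. \<bar>\<rho> t - h\<bar>) \<le> d"
  shows "\<bar>W \<rho> \<omega> - block h n f \<omega>\<bar> \<le> d + e"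
proof -
  have sh: "(\<lambda>t. \<rho> (t + real n)) absolutely_integrable_on {0..}"
    by (rule integral_shift_halfline(1)[OF \<rho>]) simp
  have \<rho>n: "\<rho> absolutely_integrable_on {0..real n}" by (rule set_integrable_subset[OF \<rho>]) auto
  have dp: "W \<rho> \<omega> = V (\<lambda>z. integral {0..real n} (\<lambda>t. \<rho> t * g (z t)) + W (\<lambda>t. \<rho> (t + real n)) (z (real n))) \<omega>"
    by (rule W_DPP[OF \<rho> nonneg n pos])
  show ?thesis
    unfolding dp block_def
  proof (rule V_nonexpansive)
    show "bounded ((\<lambda>z. integral {0..real n} (\<lambda>t. \<rho> t * g (z t)) + W (\<lambda>t. \<rho> (t + real n)) (z (real n))) ` K)"
      by (intro bounded_plus_comp bounded_weighted \<rho>n bounded_subset[OF bounded_W[OF sh]]) auto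
    show "bounded ((\<lambda>z. h * integral {0..real n} (\<lambda>t. g (z t)) + f (z (real n))) ` K)"
      by (rule bounded_block_payoff[OF f])
    fix z assume "z \<in> K"
    then have "\<bar>integral {0..real n} (\<lambda>t. \<rho> t * g (z t)) - integral {0..real n} (\<lambda>t. h * g (z t))\<bar> \<le> d"
      by (intro order_trans[OF weighted_diff d] \<rho>n) (auto simp: absolutely_integrable_on_const)
    then show "\<bar>integral {0..real n} (\<lambda>t. \<rho> t * g (z t)) + W (\<lambda>t. \<rho> (t + real n)) (z (real n))
        - (h * integral {0..real n} (\<lambda>t. g (z t)) + f (z (real n)))\<bar> \<le> d + e"
      using e[of "z (real n)"] by simp
  qed
qed

lemma W_indicator:
  assumes "n \<ge> 1"
  shows "W (indicator {0..real n}) \<omega> = real n * W (unif_density (real n)) \<omega>"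
proof -
  have "(indicator {0..real n} :: real \<Rightarrow> real) absolutely_integrable_on {0..}"
    by (rule indicator_absolutely_integrable) simp
  from W_scale[OF this, of "1 / real n" \<omega>] show ?thesis
    using assms by (simp add: unif_density_def)
qed

end

section \<open>Block estimates relative to a candidate limit\<close>

locale tauberian_game_limit = tauberian_game K g V
  for K :: "(real \<Rightarrow> 'w) set" and g V +
  fixes U :: "'w \<Rightarrow> real"
  assumes U_range: "\<And>\<omega>. 0 \<le> U \<omega> \<and> U \<omega> \<le> 1"
begin

lemma bounded_U: "bounded (range (\<lambda>\<omega>. r * U \<omega>))"
proof (rule boundedI)
  fix x assume "x \<in> range (\<lambda>\<omega>. r * U \<omega>)"
  then obtain \<omega> where "x = r * U \<omega>" by blast
  then show "norm x \<le> \<bar>r\<bar>" using U_range[of \<omega>] by (simp add: abs_mult mult_left_le)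
qed

lemma U_diff: "\<bar>a * U \<omega> - b * U \<omega>\<bar> \<le> \<bar>a - b\<bar>"
proof -
  have "\<bar>a * U \<omega> - b * U \<omega>\<bar> = \<bar>a - b\<bar> * U \<omega>"
    using U_range[of \<omega>] by (simp add: left_diff_distrib[symmetric] abs_mult)
  also have "\<dots> \<le> \<bar>a - b\<bar>" using U_range[of \<omega>] by (simp add: mult_left_le)
  finally show ?thesis .
qed

text \<open>The indicator is exactly 1 on the block, so there is no running error and
  \<open>e\<close> passes through unchanged. It serves in both directions: to deduce block estimates
  from uniform values, and to lengthen a horizon by one block.\<close>

lemma W_indicator_block:
  assumes M: "M \<ge> 1" and n: "n \<ge> 1" and e: "\<And>\<omega>. \<bar>W (indicator {0..real M}) \<omega> - real M * U \<omega>\<bar> \<le> e"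
  shows "\<bar>W (indicator {0..real (n + M)}) \<omega> - block 1 n (\<lambda>\<omega>. real M * U \<omega>) \<omega>\<bar> \<le> e"
proof -
  let ?\<rho> = "indicator {0..real (n + M)} :: real \<Rightarrow> real"
  have \<rho>: "?\<rho> absolutely_integrable_on {0..}"
    by (rule indicator_absolutely_integrable) simp
  have sh: "?\<rho> (t + real n) = indicator {0..real M} t" if "t \<ge> 0" for t
    using that by (auto simp: indicator_def)
  have "integral {real n..} ?\<rho> = integral {0..} (\<lambda>t. ?\<rho> (t + real n))"
    by (rule integral_shift_halfline(2)[OF \<rho>, symmetric]) simp
  also have "\<dots> = integral {0..} (indicator {0..real M} :: real \<Rightarrow> real)"
    using sh by (intro integral_cong) auto
  also have "\<dots> = real M"
    by (rule integral_unique[OF indicator_atLeastAtMost_has_integral]) simp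
  finally have tail: "integral {real n..} ?\<rho> = real M" .
  have "integral {0..real n} (\<lambda>t. \<bar>?\<rho> t - 1\<bar>) = integral {0..real n} (\<lambda>_. 0)"
    by (intro integral_cong) (auto simp: indicator_def)
  then have "\<bar>W ?\<rho> \<omega> - block 1 n (\<lambda>\<omega>. real M * U \<omega>) \<omega>\<bar> \<le> 0 + e"
    by (intro W_block[OF \<rho> _ n _ bounded_U]) (use M e W_cong[OF sh] tail in simp_all)
  then show ?thesis by simp
qed

text \<open>For an integer \<open>r\<close> one compares the uniform values on [0, r] and
  [0, n + r]. A real \<open>r\<close> is rounded down to \<open>M\<close>, at a cost of at most 1 in
  the terminal payoff and 1 in the target. Only \<open>r\<close> has to be large; the length
  \<open>n\<close> of the block is arbitrary.\<close>

lemma block_asymptotics: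
  assumes lim: "uniform_limit UNIV (\<lambda>n. W (unif_density (real n))) U sequentially" and \<epsilon>: "\<epsilon> > 0"
  obtains r0 where "r0 > 0"
    "\<And>n \<omega>. real n \<ge> r0 \<Longrightarrow> \<bar>W (indicator {0..real n}) \<omega> - real n * U \<omega>\<bar> \<le> \<epsilon> * real n"
    "\<And>r n \<omega>. r \<ge> r0 \<Longrightarrow> n \<ge> 1 \<Longrightarrow> \<bar>block 1 n (\<lambda>\<omega>. r * U \<omega>) \<omega> - (real n + r) * U \<omega>\<bar> \<le> \<epsilon> * (real n + r)"
proof -
  have "eventually (\<lambda>n. \<forall>\<omega>\<in>UNIV. dist (W (unif_density (real n)) \<omega>) (U \<omega>) < \<epsilon> / 4) sequentially"
    using lim \<epsilon> by (intro uniform_limitD) auto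
  then obtain M0 where M0: "\<And>n \<omega>. n \<ge> M0 \<Longrightarrow> dist (W (unif_density (real n)) \<omega>) (U \<omega>) < \<epsilon> / 4"
    by (auto simp: eventually_sequentially)
  have ind: "\<bar>W (indicator {0..real n}) \<omega> - real n * U \<omega>\<bar> \<le> \<epsilon> / 4 * real n" if "n \<ge> M0" "n \<ge> 1" for n \<omega>
  proof -
    have "\<bar>W (indicator {0..real n}) \<omega> - real n * U \<omega>\<bar> = real n * \<bar>W (unif_density (real n)) \<omega> - U \<omega>\<bar>"
      using W_indicator[OF that(2)] by (simp add: right_diff_distrib[symmetric] abs_mult)
    also have "\<dots> \<le> real n * (\<epsilon> / 4)"
      using M0[OF that(1), of \<omega>] by (intro mult_left_mono) (auto simp: dist_real_def)
    finally show ?thesis by (simp add: mult.commute)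
  qed
  \<comment> \<open>The summand 2 keeps the rounded \<open>M\<close> above \<open>M0\<close> and
    positive; 4 / \<epsilon> makes \<epsilon> r / 2 absorb the two rounding errors.\<close>
  define r0 where "r0 = real M0 + 2 + 4 / \<epsilon>"
  show thesis
  proof (rule that[of r0])
    show "r0 > 0" using \<epsilon> by (simp add: r0_def add_pos_pos)
    have r0: "r0 \<ge> real M0 + 2" using \<epsilon> by (simp add: r0_def)
    show "\<bar>W (indicator {0..real n}) \<omega> - real n * U \<omega>\<bar> \<le> \<epsilon> * real n" if "real n \<ge> r0" for n \<omega>
    proof -
      have "n \<ge> M0" "n \<ge> 1" using that r0 by linarith+
      moreover have "\<epsilon> / 4 * real n \<le> \<epsilon> * real n" using \<epsilon> by (intro mult_right_mono) auto
      ultimately show ?thesis using ind[of n \<omega>] by linarith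
    qed
    fix r :: real and n :: nat and \<omega> assume r: "r \<ge> r0" and n: "n \<ge> 1"
    define M where "M = nat \<lfloor>r\<rfloor>"
    have M: "real M \<le> r" "r < real M + 1" using r r0 by (simp_all add: M_def)
    then have M': "M \<ge> M0" "M \<ge> 1" using r r0 by linarith+
    have 1: "\<bar>block 1 n (\<lambda>\<omega>. r * U \<omega>) \<omega> - block 1 n (\<lambda>\<omega>. real M * U \<omega>) \<omega>\<bar> \<le> 1"
      using M by (intro block_diff bounded_U order_trans[OF U_diff]) auto
    have 2: "\<bar>W (indicator {0..real (n + M)}) \<omega> - block 1 n (\<lambda>\<omega>. real M * U \<omega>) \<omega>\<bar> \<le> \<epsilon> / 4 * real M"
      using M' n ind by (intro W_indicator_block) auto
    have 3: "\<bar>W (indicator {0..real (n + M)}) \<omega> - real (n + M) * U \<omega>\<bar> \<le> \<epsilon> / 4 * real (n + M)"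
      using M' n by (intro ind) auto
    have 4: "\<bar>(real n + r) * U \<omega> - real (n + M) * U \<omega>\<bar> \<le> 1"
      using M by (intro order_trans[OF U_diff]) auto
    have "\<epsilon> / 2 * r \<ge> \<epsilon> / 2 * (4 / \<epsilon>)" using r \<epsilon> by (intro mult_left_mono) (auto simp: r0_def)
    then have 5: "\<epsilon> / 2 * r \<ge> 2" using \<epsilon> by simp
    have 6: "\<epsilon> * real M \<le> \<epsilon> * r" "0 \<le> \<epsilon> * real n" using M \<epsilon> by auto
    show "\<bar>block 1 n (\<lambda>\<omega>. r * U \<omega>) \<omega> - (real n + r) * U \<omega>\<bar> \<le> \<epsilon> * (real n + r)"
    proof -
      have "\<epsilon> / 4 * real M + \<epsilon> / 4 * real (n + M) + 2 \<le> \<epsilon> * (real n + r)"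
      proof -
        have "x / 4 + (y + x) / 4 + 2 \<le> y + w" if "w / 2 \<ge> 2" "x \<le> w" "0 \<le> y" for x y w :: real
          using that by argo
        from this[of "\<epsilon> * r" "\<epsilon> * real M" "\<epsilon> * real n"] show ?thesis
          using 5 6 by (simp add: distrib_left)
      qed
      then show ?thesis using 1 2 3 4 by linarith
    qed
  qed
qed

text \<open>Induction removes the first block, whence the generalisation over \<open>h\<close>; each
  block contributes at most \<epsilon> times the total mass. Hypothesis \<open>Na\<close> guarantees
  that the mass after any block but the last is at least \<open>r0\<close> times the height of that
  block, as \<open>blk\<close> requires.\<close>

lemma W_step_fun:
  assumes ind: "\<And>\<omega>. \<bar>W (indicator {0..real N}) \<omega> - real N * U \<omega>\<bar> \<le> \<epsilon> * real N"
    and blk: "\<And>r \<omega>. r \<ge> r0 \<Longrightarrow>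
      \<bar>block 1 N (\<lambda>\<omega>. r * U \<omega>) \<omega> - (real N + r) * U \<omega>\<bar> \<le> \<epsilon> * (real N + r)"
    and N: "N \<ge> 1" and a: "a > 0" and Na: "real N * a \<ge> r0 * b" and \<epsilon>: "\<epsilon> \<ge> 0" and r0: "r0 \<ge> 0"
    and m: "m \<ge> 1" and h: "\<And>i. i < m \<Longrightarrow> a \<le> h i \<and> h i \<le> b"
  shows "\<bar>W (step_fun N h m) \<omega> - real N * (\<Sum>i<m. h i) * U \<omega>\<bar> \<le> real m * \<epsilon> * (real N * (\<Sum>i<m. h i))"
  using m h
proof (induction m arbitrary: h \<omega> rule: nat_induct_at_least)
  case base
  have h0: "h 0 > 0" using base[of 0] a by simp
  have eq: "step_fun N h 1 t = (if t = real N then 0 else h 0 * indicator {0..real N} t)" for t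
    by (auto simp: step_fun_def indicator_def)
  have i1: "step_fun N h 1 absolutely_integrable_on {0..}"
    using h0 by (intro has_integral_nonneg_absolutely[OF step_fun_has_integral] step_fun_nonneg) auto
  have i2: "(indicator {0..real N} :: real \<Rightarrow> real) absolutely_integrable_on {0..}"
    by (rule indicator_absolutely_integrable) simp
  have i3: "(\<lambda>t. h 0 * indicator {0..real N} t) absolutely_integrable_on {0..}"
    using i2 by simp
  \<comment> \<open>The half-open step and the closed interval differ at the single point
    \<open>real N\<close>.\<close>
  have "integral {0..} (\<lambda>t. \<bar>step_fun N h 1 t - h 0 * indicator {0..real N} t\<bar>) = integral {0..} (\<lambda>t::real. 0)"
    by (rule integral_spike[of "{real N}"]) (auto simp: eq simp del: One_nat_def)
  then have "W (step_fun N h 1) \<omega> = W (\<lambda>t. h 0 * indicator {0..real N} t) \<omega>"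
    using W_diff[OF i1 i3, of \<omega>] by simp
  also have "\<dots> = h 0 * W (indicator {0..real N}) \<omega>" using h0 by (intro W_scale i2) auto
  finally have "W (step_fun N h 1) \<omega> - real N * h 0 * U \<omega> = h 0 * (W (indicator {0..real N}) \<omega> - real N * U \<omega>)"
    by (simp only: right_diff_distrib mult_ac)
  then have "\<bar>W (step_fun N h 1) \<omega> - real N * h 0 * U \<omega>\<bar> = h 0 * \<bar>W (indicator {0..real N}) \<omega> - real N * U \<omega>\<bar>"
    using h0 by (simp only: abs_mult abs_of_pos)
  also have "\<dots> \<le> h 0 * (\<epsilon> * real N)" using ind h0 by (intro mult_left_mono) auto
  finally show ?case by (simp add: mult_ac)
next
  case (Suc m)
  define \<rho> where "\<rho> = step_fun N h (Suc m)"
  define R where "R = real N * (\<Sum>i<m. h (Suc i))"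
  have hb: "a \<le> h (Suc i) \<and> h (Suc i) \<le> b" if "i < m" for i using Suc.prems[of "Suc i"] that by auto
  have h0: "h 0 > 0" "h 0 \<le> b" using Suc.prems[of 0] a by auto
  have \<rho>: "\<rho> absolutely_integrable_on {0..}" and \<rho>0: "\<rho> t \<ge> 0" for t
    unfolding \<rho>_def using Suc.prems a
    by (intro has_integral_nonneg_absolutely[OF step_fun_has_integral] step_fun_nonneg; force)+
  have sh: "\<rho> (t + real N) = step_fun N (\<lambda>i. h (Suc i)) m t" if "t \<ge> 0" for t
    unfolding \<rho>_def using that by (rule step_fun_shift)
  have "integral {real N..} \<rho> = integral {0..} (\<lambda>t. \<rho> (t + real N))"
    by (rule integral_shift_halfline(2)[OF \<rho>, symmetric]) simp
  also have "\<dots> = integral {0..} (step_fun N (\<lambda>i. h (Suc i)) m)"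
    using sh by (intro integral_cong) auto
  finally have tail: "integral {real N..} \<rho> = R"
    by (simp add: R_def integral_unique[OF step_fun_has_integral])
  \<comment> \<open>The next block alone already carries mass N a, enough to bound the remaining
    mass from below.\<close>
  have "a \<le> h (Suc 0)" using hb[of 0] Suc.hyps by simp
  also have "\<dots> \<le> (\<Sum>i<m. h (Suc i))"
    using member_le_sum[of 0 "{..<m}" "\<lambda>i. h (Suc i)"] Suc.hyps hb a by force
  finally have "real N * a \<le> R" unfolding R_def by (intro mult_left_mono) auto
  then have R: "R \<ge> r0 * b" "R > 0" using Na a N by (auto intro: less_le_trans[of 0 "real N * a"])
  have "R \<ge> r0 * h 0" using R h0 r0 mult_left_mono[of "h 0" b r0] by linarith
  then have Rr: "R / h 0 \<ge> r0" using h0 by (simp add: field_simps)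
  \<comment> \<open>At the right endpoint the step function already has its next height, so that
    point is excepted.\<close>
  have d: "integral {0..real N} (\<lambda>t. \<bar>\<rho> t - h 0\<bar>) = integral {0..real N} (\<lambda>_. 0)"
    by (rule integral_spike[of "{real N}"]) (auto simp: \<rho>_def step_fun_eq[of 0])
  have 1: "\<bar>W \<rho> \<omega> - block (h 0) N (\<lambda>\<omega>. R * U \<omega>) \<omega>\<bar> \<le> 0 + real m * \<epsilon> * R"
  proof (rule W_block[OF \<rho> \<rho>0 N])
    show "\<bar>W (\<lambda>t. \<rho> (t + real N)) \<omega> - R * U \<omega>\<bar> \<le> real m * \<epsilon> * R" for \<omega>
      using Suc.IH[of "\<lambda>i. h (Suc i)" \<omega>] hb W_cong[OF sh] by (simp add: R_def)
  qed (use tail R d bounded_U in auto)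
  have "block (h 0) N (\<lambda>\<omega>. R * U \<omega>) \<omega> = h 0 * block 1 N (\<lambda>\<omega>. R / h 0 * U \<omega>) \<omega>"
    using block_scale[OF bounded_U[of "R / h 0"], of "h 0" 1 N \<omega>] h0 by simp
  moreover have "(real N * h 0 + R) * U \<omega> = h 0 * ((real N + R / h 0) * U \<omega>)"
    using h0 by (simp add: distrib_left distrib_right)
  ultimately have "block (h 0) N (\<lambda>\<omega>. R * U \<omega>) \<omega> - (real N * h 0 + R) * U \<omega>
      = h 0 * (block 1 N (\<lambda>\<omega>. R / h 0 * U \<omega>) \<omega> - (real N + R / h 0) * U \<omega>)"
    by (simp only: right_diff_distrib)
  then have "\<bar>block (h 0) N (\<lambda>\<omega>. R * U \<omega>) \<omega> - (real N * h 0 + R) * U \<omega>\<bar>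
      = h 0 * \<bar>block 1 N (\<lambda>\<omega>. R / h 0 * U \<omega>) \<omega> - (real N + R / h 0) * U \<omega>\<bar>"
    using h0 by (simp only: abs_mult abs_of_pos)
  also have "\<dots> \<le> h 0 * (\<epsilon> * (real N + R / h 0))" using blk[OF Rr] h0 by (intro mult_left_mono) auto
  also have "\<dots> = \<epsilon> * (real N * h 0 + R)" using h0 by (simp add: field_simps)
  finally have 2: "\<bar>block (h 0) N (\<lambda>\<omega>. R * U \<omega>) \<omega> - (real N * h 0 + R) * U \<omega>\<bar> \<le> \<epsilon> * (real N * h 0 + R)" .
  have "real m * \<epsilon> * R \<le> real m * \<epsilon> * (real N * h 0 + R)"
    using \<epsilon> h0 by (intro mult_left_mono) auto
  then have "\<bar>W \<rho> \<omega> - (real N * h 0 + R) * U \<omega>\<bar> \<le> real (Suc m) * \<epsilon> * (real N * h 0 + R)"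
    using 1 2 by (simp add: algebra_simps)
  moreover have "real N * h 0 + R = real N * (\<Sum>i<Suc m. h i)"
    unfolding R_def sum.lessThan_Suc_shift by (simp add: algebra_simps)
  ultimately show ?case by (simp add: \<rho>_def)
qed

section \<open>From uniform densities to scaled densities\<close>

text \<open>Constants are chosen in the order \<eta>, \<open>m\<close>, \<open>r0\<close>,
  \<open>N\<close>: the accuracy of the block estimate depends on the number of steps, and the width
  of the steps on the threshold of that estimate.\<close>

lemma scale_limit:
  assumes lim: "uniform_limit UNIV (\<lambda>n. W (unif_density (real n))) U sequentially"
    and \<mu>: "prob_density \<mu>"
  shows "uniform_limit UNIV (\<lambda>l. W (scale_density \<mu> l)) U (at_right 0)"
proof (rule uniform_limitI)
  fix e :: real assume e: "e > 0"
  \<comment> \<open>The total error is 4 \<eta>: \<eta> from the approximation, \<eta> M \<le> 2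
    \<eta> from the blocks, and \<eta> from the mass \<open>M\<close> of the step function not being
    exactly 1.\<close>
  define \<eta> where "\<eta> = min 1 (e / 8)"
  have \<eta>: "\<eta> > 0" "\<eta> \<le> 1" "\<eta> \<le> e / 8" using e by (auto simp: \<eta>_def)
  obtain m \<kappa> C where m: "m \<ge> (1::nat)" and \<kappa>: "\<kappa> > (0::real)" and C: "C > (0::real)"
    and ev: "\<And>Q. eventually (\<lambda>l. \<exists>N h. real N \<ge> Q \<and> (\<forall>i<m. l * \<kappa> \<le> h i \<and> h i \<le> l * C) \<and>
       integral {0..} (\<lambda>t. \<bar>scale_density \<mu> l t - step_fun N h m t\<bar>) \<le> \<eta>) (at_right 0)"
    by (rule positive_step_approximation[OF \<mu> \<eta>(1)]) (rule that)
  have "\<eta> / real m > 0" using \<eta> m by simp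
  then obtain r0 where r0: "r0 > 0"
    and ind: "\<And>n \<omega>. real n \<ge> r0 \<Longrightarrow> \<bar>W (indicator {0..real n}) \<omega> - real n * U \<omega>\<bar> \<le> \<eta> / real m * real n"
    and blk: "\<And>r n \<omega>. r \<ge> r0 \<Longrightarrow> n \<ge> 1 \<Longrightarrow>
      \<bar>block 1 n (\<lambda>\<omega>. r * U \<omega>) \<omega> - (real n + r) * U \<omega>\<bar> \<le> \<eta> / real m * (real n + r)"
    by (rule block_asymptotics[OF lim]) (rule that)
  \<comment> \<open>The bound \<open>r0\<close> is for the last block, a pure indicator; r0 C /
    \<kappa> gives \<open>Na\<close>, where the scale \<open>l\<close> cancels from both height
    bounds.\<close>
  let ?Q = "max 1 (max r0 (r0 * C / \<kappa>))"
  show "\<forall>\<^sub>F l in at_right 0. \<forall>\<omega>\<in>UNIV. dist (W (scale_density \<mu> l) \<omega>) (U \<omega>) < e"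
    using ev[of ?Q] eventually_at_right_less[of 0]
  proof eventually_elim
    case (elim l)
    then obtain N h where N: "real N \<ge> 1" "real N \<ge> r0" "real N \<ge> r0 * C / \<kappa>"
      and h: "\<And>i. i < m \<Longrightarrow> l * \<kappa> \<le> h i \<and> h i \<le> l * C"
      and L1: "integral {0..} (\<lambda>t. \<bar>scale_density \<mu> l t - step_fun N h m t\<bar>) \<le> \<eta>"
      by auto
    have l: "l > 0" using elim by simp
    have sp: "prob_density (scale_density \<mu> l)" by (rule prob_density_scale[OF \<mu> l])
    have sabs: "scale_density \<mu> l absolutely_integrable_on {0..}"
      by (rule prob_density_absolutely_integrable[OF sp])
    have h0: "0 \<le> h i" if "i < m" for i using h[OF that] l \<kappa> by (meson mult_pos_pos less_imp_le order_trans)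
    have stabs: "step_fun N h m absolutely_integrable_on {0..}"
      using step_fun_has_integral by (rule has_integral_nonneg_absolutely) (use h0 step_fun_nonneg in auto)
    define M where "M = real N * (\<Sum>i<m. h i)"
    have "integral {0..} (scale_density \<mu> l) = 1" using sp by (simp add: prob_density_def integral_unique)
    then have M: "\<bar>1 - M\<bar> \<le> \<eta>"
      using integral_abs_diff_le[OF sabs stabs] L1 integral_unique[OF step_fun_has_integral[of N h m]]
      by (simp add: M_def)
    have Na: "real N * (l * \<kappa>) \<ge> r0 * (l * C)"
    proof -
      have "real N * \<kappa> \<ge> r0 * C" using N(3) \<kappa> by (simp add: field_simps)
      then have "l * (real N * \<kappa>) \<ge> l * (r0 * C)" using l by (intro mult_left_mono) auto
      then show ?thesis by (simp add: mult_ac)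
    qed
    have "dist (W (scale_density \<mu> l) \<omega>) (U \<omega>) < e" for \<omega>
    proof -
      have 1: "\<bar>W (scale_density \<mu> l) \<omega> - W (step_fun N h m) \<omega>\<bar> \<le> \<eta>"
        using W_diff[OF sabs stabs, of \<omega>] L1 by linarith
      have "\<bar>W (step_fun N h m) \<omega> - real N * (\<Sum>i<m. h i) * U \<omega>\<bar> \<le> real m * (\<eta> / real m) * (real N * (\<Sum>i<m. h i))"
        by (rule W_step_fun[where ?r0.0 = r0 and a = "l * \<kappa>" and b = "l * C"])
          (use ind blk N m \<kappa> l r0 \<eta> Na h in auto)
      then have 2: "\<bar>W (step_fun N h m) \<omega> - M * U \<omega>\<bar> \<le> \<eta> * M" using m by (simp add: M_def)
      have 3: "\<bar>M * U \<omega> - U \<omega>\<bar> \<le> \<eta>" using U_diff[of M \<omega> 1] M by (simp add: abs_minus_commute)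
      have "\<eta> * M \<le> \<eta> * 2" using M \<eta> by (intro mult_left_mono) auto
      then show ?thesis using 1 2 3 \<eta> unfolding dist_real_def by linarith
    qed
    then show ?case by simp
  qed
qed

lemma power_limit:
  assumes lim: "uniform_limit UNIV (\<lambda>n. W (unif_density (real n))) U sequentially"
    and \<rho>: "power_density \<rho>"
  shows "uniform_limit UNIV (\<lambda>T. W (shift_density \<rho> T)) U at_top"
proof -
  obtain \<alpha> \<beta> \<gamma> where \<alpha>: "\<alpha> > 0" and \<beta>: "\<beta> > 0" and pd: "prob_density \<rho>"
    and eq: "\<And>t. t \<ge> 0 \<Longrightarrow> \<rho> t = (\<alpha> + \<beta> * t) powr (- \<gamma>)"
    using \<rho> unfolding power_density_def by blast
  have \<gamma>: "\<gamma> > 1" by (rule power_density_exponent_gt_1[OF pd \<alpha> \<beta> eq])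
  have l: "filterlim (\<lambda>T. \<beta> / (\<alpha> + \<beta> * T)) (at_right 0) at_top"
    unfolding filterlim_at
  proof
    have "filterlim (\<lambda>T. \<alpha> + \<beta> * T) at_top at_top"
      using \<beta> by (intro filterlim_tendsto_add_at_top[OF tendsto_const] filterlim_tendsto_pos_mult_at_top[OF tendsto_const]) (auto simp: filterlim_ident)
    then show "((\<lambda>T. \<beta> / (\<alpha> + \<beta> * T)) \<longlongrightarrow> 0) at_top"
      by (intro real_tendsto_divide_at_top[OF tendsto_const])
    show "\<forall>\<^sub>F T in at_top. \<beta> / (\<alpha> + \<beta> * T) \<in> {0<..} \<and> \<beta> / (\<alpha> + \<beta> * T) \<noteq> 0"
      using eventually_ge_at_top[of 0]
    proof eventually_elim
      case (elim T)
      then have "\<alpha> + \<beta> * T > 0" using \<alpha> \<beta> by (intro add_pos_nonneg) auto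
      then show ?case using \<beta> by simp
    qed
  qed
  have "uniform_limit UNIV (\<lambda>T. W (scale_density (power_profile \<gamma>) (\<beta> / (\<alpha> + \<beta> * T)))) U at_top"
    by (rule filterlim_compose[OF scale_limit[OF lim prob_density_power_profile[OF \<gamma>]] l])
  moreover have "eventually (\<lambda>T. W (scale_density (power_profile \<gamma>) (\<beta> / (\<alpha> + \<beta> * T))) = W (shift_density \<rho> T)) at_top"
    using eventually_ge_at_top[of 0]
    by eventually_elim (use power_density_shift(2)[OF \<alpha> \<beta> \<gamma> _ eq] in \<open>auto intro!: W_cong\<close>)
  ultimately show ?thesis by (subst filterlim_cong[OF refl refl, symmetric]) auto
qed

text \<open>Passes from integer to real horizons by reading \<open>unif_density T\<close> as the
  scaling of \<open>unif_density 1\<close> by 1 / T.\<close>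

lemma unif_limit:
  assumes lim: "uniform_limit UNIV (\<lambda>n. W (unif_density (real n))) U sequentially"
  shows "uniform_limit UNIV (\<lambda>T. W (unif_density T)) U at_top"
proof -
  have "uniform_limit UNIV (\<lambda>T. W (scale_density (unif_density 1) (inverse T))) U at_top"
    by (rule filterlim_compose[OF scale_limit[OF lim prob_density_unif] filterlim_inverse_at_right_top]) simp
  moreover have "eventually (\<lambda>T. W (scale_density (unif_density 1) (inverse T)) = W (unif_density T)) at_top"
    using eventually_gt_at_top[of 0] by eventually_elim (simp add: scale_unif_density divide_inverse)
  ultimately show ?thesis by (subst filterlim_cong[OF refl refl, symmetric]) auto
qed

lemma exp_limit:
  assumes lim: "uniform_limit UNIV (\<lambda>n. W (unif_density (real n))) U sequentially"
  shows "uniform_limit UNIV (\<lambda>l. W (exp_density l)) U (at_right 0)"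
  using scale_limit[OF lim prob_density_exp[of 1]] by (simp add: scale_exp_density)

section \<open>From exponential and power densities to uniform densities\<close>

text \<open>The invariant \<open>good\<close> is arranged so that a block of length \<open>N\<close>
  raises both the actual error and the allowed one by \<delta> N. Its steps may jump over a given
  \<open>n\<close>; but a block is short relative to the horizon, so some good horizon lies within
  \<delta> n below \<open>n\<close>.\<close>

lemma uniform_limit_if_block_estimate:
  assumes H: "\<And>\<delta>::real. 0 < \<delta> \<Longrightarrow> \<delta> \<le> 1 \<Longrightarrow> \<exists>n0\<ge>1. \<forall>n\<ge>n0. \<exists>N\<ge>1. real N \<le> \<delta> * real n \<and>
      (\<forall>\<omega>. \<bar>block 1 N (\<lambda>\<omega>. real n * U \<omega>) \<omega> - real (N + n) * U \<omega>\<bar> \<le> \<delta> * real N)"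
  shows "uniform_limit UNIV (\<lambda>n. W (unif_density (real n))) U sequentially"
proof (rule uniform_limitI)
  fix e :: real assume e: "e > 0"
  \<comment> \<open>For large \<open>n\<close> the relative error will be at most 4 \<delta> \<le> e
    / 2: one \<delta> from the initial error, one from the blocks, two from moving between
    \<open>k\<close> and \<open>n\<close>.\<close>
  define \<delta> where "\<delta> = min 1 (e / 8)"
  have \<delta>: "\<delta> > 0" "\<delta> \<le> 1" "\<delta> \<le> e / 8" using e by (auto simp: \<delta>_def)
  obtain n0 where n0: "n0 \<ge> 1" and est: "\<And>n. n \<ge> n0 \<Longrightarrow> \<exists>N\<ge>1. real N \<le> \<delta> * real n \<and>
      (\<forall>\<omega>. \<bar>block 1 N (\<lambda>\<omega>. real n * U \<omega>) \<omega> - real (N + n) * U \<omega>\<bar> \<le> \<delta> * real N)"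
    using H[OF \<delta>(1,2)] by blast
  \<comment> \<open>The term 2 n0 is the trivial bound at the starting horizon, where both the value
    and n0 U lie in [-n0, n0].\<close>
  define good where "good n \<longleftrightarrow>
    (\<forall>\<omega>. \<bar>W (indicator {0..real n}) \<omega> - real n * U \<omega>\<bar> \<le> 2 * real n0 + \<delta> * real n)" for n
  have ind_diff: "\<bar>W (indicator {0..real n}) \<omega> - W (indicator {0..real k}) \<omega>\<bar> \<le> real n - real k"
    if "k \<le> n" for k n \<omega>
  proof -
    have "((indicator {real k<..real n} :: real \<Rightarrow> real) has_integral (real n - real k)) {0..}"
      by (rule has_integral_indicator_halfline) (use that in \<open>auto simp: subset_iff\<close>)
    moreover have "\<bar>indicator {0..real n} t - indicator {0..real k} t\<bar> = (indicator {real k<..real n} t :: real)"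
      if "t \<in> {0..}" for t
      using that \<open>k \<le> n\<close> by (auto simp: indicator_def)
    ultimately have "integral {0..} (\<lambda>t. \<bar>indicator {0..real n} t - indicator {0..real k} t\<bar>) = real n - real k"
      by (metis (no_types, lifting) integral_cong integral_unique)
    then show ?thesis
      using W_diff[OF indicator_absolutely_integrable indicator_absolutely_integrable, of "real n" "real k" \<omega>] by simp
  qed
  have good0: "good n0"
    unfolding good_def
  proof
    fix \<omega>
    have "\<bar>W (indicator {0..real n0}) \<omega>\<bar> \<le> real n0"
      using W_diff[of "indicator {0..real n0}" "\<lambda>_. 0" \<omega>] W_zero[of \<omega>]
        indicator_absolutely_integrable[of "real n0"]
        integral_unique[OF indicator_atLeastAtMost_has_integral[of "real n0"]] by simp
    moreover have "\<bar>real n0 * U \<omega>\<bar> \<le> real n0" using U_diff[of "real n0" \<omega> 0] by simp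
    moreover have "0 \<le> \<delta> * real n0" using \<delta> by simp
    ultimately show "\<bar>W (indicator {0..real n0}) \<omega> - real n0 * U \<omega>\<bar> \<le> 2 * real n0 + \<delta> * real n0"
      by linarith
  qed
  have bound: "\<bar>W (indicator {0..real n}) \<omega> - real n * U \<omega>\<bar> \<le> 2 * real n0 + 3 * \<delta> * real n" if n: "n \<ge> n0" for n \<omega>
  proof -
    \<comment> \<open>For the largest good \<open>k\<close> up to \<open>n\<close>, the next good
      horizon N + k must exceed \<open>n\<close>; hence n - k < N \<le> \<delta> k.\<close>
    define A where "A = {k. n0 \<le> k \<and> k \<le> n \<and> good k}"
    have fin: "finite A" unfolding A_def by (rule finite_subset[of _ "{..n}"]) auto
    have "n0 \<in> A" using n good0 by (simp add: A_def)
    then have kA: "Max A \<in> A" using fin by (intro Max_in) auto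
    define k where "k = Max A"
    have k: "n0 \<le> k" "k \<le> n" "good k" using kA by (auto simp: A_def k_def)
    obtain N where N: "N \<ge> 1" "real N \<le> \<delta> * real k"
      and bl: "\<And>\<omega>. \<bar>block 1 N (\<lambda>\<omega>. real k * U \<omega>) \<omega> - real (N + k) * U \<omega>\<bar> \<le> \<delta> * real N"
      using est[OF k(1)] by blast
    have "good (N + k)"
      unfolding good_def
    proof
      fix \<omega>
      have "\<bar>W (indicator {0..real (N + k)}) \<omega> - block 1 N (\<lambda>\<omega>. real k * U \<omega>) \<omega>\<bar> \<le> 2 * real n0 + \<delta> * real k"
        using k n0 N by (intro W_indicator_block) (auto simp: good_def)
      moreover have "\<delta> * real (N + k) = \<delta> * real N + \<delta> * real k" by (simp add: distrib_left)
      ultimately show "\<bar>W (indicator {0..real (N + k)}) \<omega> - real (N + k) * U \<omega>\<bar> \<le> 2 * real n0 + \<delta> * real (N + k)"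
        using bl[of \<omega>] by linarith
    qed
    moreover have "N + k \<notin> A"
    proof
      assume "N + k \<in> A"
      then have "N + k \<le> k" unfolding k_def using fin by (intro Max_ge) auto
      then show False using N(1) by simp
    qed
    ultimately have "n < N + k" using k by (auto simp: A_def)
    then have "real n - real k \<le> \<delta> * real k" using N(2) by linarith
    moreover have "\<delta> * real k \<le> \<delta> * real n" using k \<delta> by simp
    ultimately have nk: "real n - real k \<le> \<delta> * real n" "\<delta> * real k \<le> \<delta> * real n" by linarith+
    have "\<bar>W (indicator {0..real k}) \<omega> - real k * U \<omega>\<bar> \<le> 2 * real n0 + \<delta> * real k"
      using k(3) by (simp add: good_def)
    moreover have "\<bar>real n * U \<omega> - real k * U \<omega>\<bar> \<le> real n - real k"
      using U_diff[of "real n" \<omega> "real k"] k(2) by simp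
    ultimately have "\<bar>W (indicator {0..real n}) \<omega> - real n * U \<omega>\<bar> \<le> 2 * real n0 + \<delta> * real n + 2 * (\<delta> * real n)"
      using ind_diff[OF k(2), of \<omega>] nk by linarith
    then show ?thesis by (simp add: algebra_simps)
  qed
  obtain n1 :: nat where n1: "real n1 \<ge> 2 * real n0 / \<delta>" using real_arch_simple by blast
  show "\<forall>\<^sub>F n in sequentially. \<forall>\<omega>\<in>UNIV. dist (W (unif_density (real n)) \<omega>) (U \<omega>) < e"
    using eventually_ge_at_top[of "max n0 n1"]
  proof eventually_elim
    case (elim n)
    then have n: "n \<ge> n0" "n \<ge> 1" "real n \<ge> 2 * real n0 / \<delta>" using n0 n1 by auto
    have "dist (W (unif_density (real n)) \<omega>) (U \<omega>) < e" for \<omega>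
    proof -
      have "2 * real n0 \<le> \<delta> * real n" using n(3) \<delta> by (simp add: field_simps)
      then have "\<bar>W (indicator {0..real n}) \<omega> - real n * U \<omega>\<bar> \<le> 4 * \<delta> * real n"
        using bound[OF n(1), of \<omega>] by (simp add: algebra_simps)
      moreover have "\<bar>W (indicator {0..real n}) \<omega> - real n * U \<omega>\<bar> = \<bar>W (unif_density (real n)) \<omega> - U \<omega>\<bar> * real n"
        using W_indicator[OF n(2)] by (simp add: right_diff_distrib[symmetric] abs_mult)
      ultimately have "\<bar>W (unif_density (real n)) \<omega> - U \<omega>\<bar> \<le> 4 * \<delta>"
        using n(2) by simp
      then show ?thesis using \<delta> e by (simp add: dist_real_def)
    qed
    then show ?case by simp
  qed
qed

text \<open>The height 1 / (N + n) makes h N + n h = 1: once the density is replaced by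
  \<open>h\<close> on the block, the mass left over is n h up to \<open>d\<close>, and
  \<open>W \<rho>\<close> is nearly h times the value of the unit block with terminal payoff n U.
  Dividing by \<open>h\<close> gives the claim.\<close>

lemma block_estimate_of_density:
  assumes \<rho>: "prob_density \<rho>" and n: "n \<ge> 1" and N: "N \<ge> 1" and tail: "integral {real N..} \<rho> > 0"
    and h: "h = 1 / real (N + n)" and C: "C \<ge> 0" and \<delta>: "real N \<le> \<delta> * real n"
    and near: "\<And>t. t \<ge> 0 \<Longrightarrow> \<bar>\<rho> t - h\<bar> \<le> C * h * h * t"
    and W1: "\<And>\<omega>. \<bar>W \<rho> \<omega> - U \<omega>\<bar> \<le> \<epsilon>" and W2: "\<And>\<omega>. \<bar>W (shift_density \<rho> (real N)) \<omega> - U \<omega>\<bar> \<le> \<epsilon>"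
  shows "\<bar>block 1 N (\<lambda>\<omega>. real n * U \<omega>) \<omega> - real (N + n) * U \<omega>\<bar> \<le> 2 * C * \<delta> * real N + 2 * \<epsilon> * real (N + n)"
proof -
  have \<rho>i: "\<rho> absolutely_integrable_on {0..}" by (rule prob_density_absolutely_integrable[OF \<rho>])
  have \<rho>N: "\<rho> absolutely_integrable_on {0..real N}" by (rule set_integrable_subset[OF \<rho>i]) auto
  have \<rho>0: "\<rho> t \<ge> 0" if "t \<ge> 0" for t using \<rho> that by (simp add: prob_density_def)
  have h0: "h > 0" using N h by simp
  have hc: "(\<lambda>_. h) absolutely_integrable_on {0..real N}" by (simp add: absolutely_integrable_on_const)
  have hN: "h * real N + real n * h = 1"
    using N unfolding h by (simp add: add_divide_distrib[symmetric])
  define R where "R = integral {real N..} \<rho>"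
  define d where "d = C * h * h * real N * real N"
  have d: "integral {0..real N} (\<lambda>t. \<bar>\<rho> t - h\<bar>) \<le> d"
  proof -
    have "integral {0..real N} (\<lambda>t. \<bar>\<rho> t - h\<bar>) \<le> integral {0..real N} (\<lambda>_. C * h * h * real N)"
    proof (rule integral_le)
      show "(\<lambda>t. \<bar>\<rho> t - h\<bar>) integrable_on {0..real N}"
        using set_integrable_abs[OF set_integral_diff(1)[OF \<rho>N hc]]
        by (simp add: absolutely_integrable_on_def)
      fix t assume "t \<in> {0..real N}"
      then have "\<bar>\<rho> t - h\<bar> \<le> C * h * h * t" "C * h * h * t \<le> C * h * h * real N"
        using near C h0 by (auto intro!: mult_left_mono)
      then show "\<bar>\<rho> t - h\<bar> \<le> C * h * h * real N" by linarith
    qed auto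
    then show ?thesis by (simp add: d_def mult_ac)
  qed
  have one: "integral {0..} \<rho> = 1" using \<rho> by (simp add: prob_density_def integral_unique)
  then have R1: "R = 1 - integral {0..real N} \<rho>"
    using integral_halfline_split[OF \<rho>i, of "real N"] by (simp add: R_def)
  have "\<bar>integral {0..real N} \<rho> - integral {0..real N} (\<lambda>_. h)\<bar> \<le> d"
    using integral_abs_diff_le[OF \<rho>N hc] d by linarith
  then have Rn: "\<bar>R - real n * h\<bar> \<le> d" using R1 hN by (simp add: mult.commute)
  have "0 \<le> integral {0..real N} \<rho>"
    using \<rho>0 \<rho>N by (intro integral_nonneg) (auto simp: absolutely_integrable_on_def)
  then have R01: "0 < R" "R \<le> 1" using R1 tail by (auto simp: R_def)
  have \<epsilon>: "\<epsilon> \<ge> 0" using W1[of undefined] by linarith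
  have sh: "(\<lambda>t. \<rho> (t + real N)) absolutely_integrable_on {0..}"
    by (rule integral_shift_halfline(1)[OF \<rho>i]) simp
  have W3: "\<bar>W (\<lambda>t. \<rho> (t + real N)) \<omega> - R * U \<omega>\<bar> \<le> \<epsilon>" for \<omega>
  proof -
    have "shift_density \<rho> (real N) = (\<lambda>t. (1 / R) * \<rho> (t + real N))" by (simp add: shift_density_def R_def)
    then have "W (shift_density \<rho> (real N)) \<omega> = W (\<lambda>t. \<rho> (t + real N)) \<omega> / R"
      using W_scale[OF sh, of "1 / R" \<omega>] R01 by simp
    then have "W (\<lambda>t. \<rho> (t + real N)) \<omega> - R * U \<omega> = R * (W (shift_density \<rho> (real N)) \<omega> - U \<omega>)"
      using R01 by (simp add: right_diff_distrib)
    then have "\<bar>W (\<lambda>t. \<rho> (t + real N)) \<omega> - R * U \<omega>\<bar> = R * \<bar>W (shift_density \<rho> (real N)) \<omega> - U \<omega>\<bar>"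
      using R01 by (simp add: abs_mult)
    also have "\<dots> \<le> 1 * \<epsilon>" using R01 W2 by (intro mult_mono) auto
    finally show ?thesis by simp
  qed
  have 1: "\<bar>W \<rho> \<omega> - block h N (\<lambda>\<omega>. R * U \<omega>) \<omega>\<bar> \<le> d + \<epsilon>"
    by (rule W_block[OF \<rho>i \<rho>0 N tail bounded_U W3 d])
  have 2: "\<bar>block h N (\<lambda>\<omega>. R * U \<omega>) \<omega> - block h N (\<lambda>\<omega>. real n * h * U \<omega>) \<omega>\<bar> \<le> d"
    using Rn by (intro block_diff bounded_U order_trans[OF U_diff])
  have 3: "block h N (\<lambda>\<omega>. real n * h * U \<omega>) \<omega> = h * block 1 N (\<lambda>\<omega>. real n * U \<omega>) \<omega>"
    using block_scale[OF bounded_U[of "real n"], of h 1 N \<omega>] h0 by (simp add: mult_ac)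
  \<comment> \<open>\<open>d\<close> is paid for the running payoff and again for replacing
    \<open>R\<close> by n h; \<epsilon> for the shifted density and again for \<open>\<rho>\<close>
    itself.\<close>
  have 4: "\<bar>h * block 1 N (\<lambda>\<omega>. real n * U \<omega>) \<omega> - U \<omega>\<bar> \<le> 2 * d + 2 * \<epsilon>"
    using 1 2 3 W1[of \<omega>] by linarith
  define p where "p = real (N + n)"
  have p: "p > 0" "p * h = 1" using N h by (auto simp: p_def)
  have "\<bar>block 1 N (\<lambda>\<omega>. real n * U \<omega>) \<omega> - p * U \<omega>\<bar> = \<bar>p * (h * block 1 N (\<lambda>\<omega>. real n * U \<omega>) \<omega> - U \<omega>)\<bar>"
    using p by (simp add: right_diff_distrib mult.assoc[symmetric])
  also have "\<dots> = p * \<bar>h * block 1 N (\<lambda>\<omega>. real n * U \<omega>) \<omega> - U \<omega>\<bar>" using p by (simp add: abs_mult)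
  also have "\<dots> \<le> p * (2 * d + 2 * \<epsilon>)" using 4 p by (intro mult_left_mono) auto
  finally have 5: "\<bar>block 1 N (\<lambda>\<omega>. real n * U \<omega>) \<omega> - p * U \<omega>\<bar> \<le> 2 * (p * d) + 2 * \<epsilon> * p" by (simp add: algebra_simps)
  \<comment> \<open>Of the two factors h in \<open>d\<close>, one is cancelled by \<open>p\<close>;
    the other, paired with N, supplies the small factor \<delta>.\<close>
  have "p * d = C * (p * h) * (h * real N) * real N" by (simp add: d_def mult_ac)
  also have "\<dots> = C * real N * (h * real N)" using p by simp
  also have "\<dots> \<le> C * real N * \<delta>"
  proof (rule mult_left_mono)
    have "h * real N \<le> real N / real n" using n N unfolding h by (simp add: field_simps)
    also have "\<dots> \<le> \<delta>" using \<delta> n by (simp add: field_simps)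
    finally show "h * real N \<le> \<delta>" .
  qed (use C in auto)
  finally show ?thesis using 5 by (simp add: p_def algebra_simps)
qed

text \<open>Isolates what exponential and power densities share: height \<open>h\<close> at 0, slope
  of order h * h with a constant independent of \<epsilon>, and values near U both before and after
  a shift.\<close>

lemma uniform_limit_if_slow_densities:
  assumes C: "C \<ge> 0"
    and fam: "\<And>\<epsilon>::real. \<epsilon> > 0 \<Longrightarrow> \<exists>h0>0. \<forall>h N. 0 < h \<longrightarrow> h < h0 \<longrightarrow> N \<ge> (1::nat) \<longrightarrow>
      (\<exists>\<rho>. prob_density \<rho> \<and> integral {real N..} \<rho> > 0 \<and> (\<forall>t\<ge>0. \<bar>\<rho> t - h\<bar> \<le> C * h * h * t) \<and>
        (\<forall>\<omega>. \<bar>W \<rho> \<omega> - U \<omega>\<bar> \<le> \<epsilon>) \<and> (\<forall>\<omega>. \<bar>W (shift_density \<rho> (real N)) \<omega> - U \<omega>\<bar> \<le> \<epsilon>))"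
  shows "uniform_limit UNIV (\<lambda>n. W (unif_density (real n))) U sequentially"
proof (rule uniform_limit_if_block_estimate)
  fix \<delta> :: real assume \<delta>: "0 < \<delta>" "\<delta> \<le> 1"
  \<comment> \<open>The ratio N / n, smaller than \<delta> so that the density error 2 C \<theta> N
    takes at most half of \<delta> N.\<close>
  define \<theta> where "\<theta> = \<delta> / (4 * C + 4)"
  have \<theta>: "0 < \<theta>" "\<theta> \<le> \<delta>" "2 * C * \<theta> \<le> \<delta> / 2"
    using \<delta> C by (auto simp: \<theta>_def field_simps)
  \<comment> \<open>The value error 2 \<epsilon> (N + n) \<le> 4 \<epsilon> n must fit into the
    other half; n is at most 2 N / \<theta>, hence the factor \<theta>.\<close>
  define \<epsilon> where "\<epsilon> = \<delta> * \<theta> / 16"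
  have \<epsilon>: "\<epsilon> > 0" using \<delta> \<theta> by (simp add: \<epsilon>_def)
  obtain h0 where h0: "h0 > 0" and ex: "\<And>h N. 0 < h \<Longrightarrow> h < h0 \<Longrightarrow> N \<ge> (1::nat) \<Longrightarrow>
      (\<exists>\<rho>. prob_density \<rho> \<and> integral {real N..} \<rho> > 0 \<and> (\<forall>t\<ge>0. \<bar>\<rho> t - h\<bar> \<le> C * h * h * t) \<and>
        (\<forall>\<omega>. \<bar>W \<rho> \<omega> - U \<omega>\<bar> \<le> \<epsilon>) \<and> (\<forall>\<omega>. \<bar>W (shift_density \<rho> (real N)) \<omega> - U \<omega>\<bar> \<le> \<epsilon>))"
    using fam[OF \<epsilon>] by blast
  \<comment> \<open>From 2 / \<theta> on, rounding \<theta> n down loses at most a factor 2; from 1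
    / h0 on, the height 1 / (N + n) is below \<open>h0\<close>.\<close>
  obtain n0 :: nat where n0: "real n0 \<ge> max 1 (max (2 / \<theta>) (1 / h0))" using real_arch_simple by blast
  show "\<exists>n0\<ge>1. \<forall>n\<ge>n0. \<exists>N\<ge>1. real N \<le> \<delta> * real n \<and>
      (\<forall>\<omega>. \<bar>block 1 N (\<lambda>\<omega>. real n * U \<omega>) \<omega> - real (N + n) * U \<omega>\<bar> \<le> \<delta> * real N)"
  proof (rule exI[of _ n0], intro conjI allI impI)
    show "n0 \<ge> 1" using n0 by simp
    fix n assume "n \<ge> n0"
    then have n: "real n \<ge> 1" "real n \<ge> 2 / \<theta>" "real n \<ge> 1 / h0" using n0 by linarith+
    define N where "N = nat \<lfloor>\<theta> * real n\<rfloor>"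
    have \<theta>n: "\<theta> * real n \<ge> 2" using n(2) \<theta> by (simp add: field_simps)
    then have N: "real N \<le> \<theta> * real n" "\<theta> * real n < real N + 1" by (auto simp: N_def)
    then have N1: "N \<ge> 1" and N2: "\<theta> * real n \<le> 2 * real N" using \<theta>n by linarith+
    define h where "h = 1 / real (N + n)"
    have hp: "0 < h" using N1 by (simp add: h_def)
    have "1 \<le> real n * h0" using n(3) h0 by (simp add: field_simps)
    also have "\<dots> < real (N + n) * h0" using N1 h0 by simp
    finally have hh: "h < h0" using N1 unfolding h_def by (simp add: field_simps)
    obtain \<rho> where \<rho>: "prob_density \<rho>" "integral {real N..} \<rho> > 0" "\<And>t. t \<ge> 0 \<Longrightarrow> \<bar>\<rho> t - h\<bar> \<le> C * h * h * t"
        "\<And>\<omega>. \<bar>W \<rho> \<omega> - U \<omega>\<bar> \<le> \<epsilon>" "\<And>\<omega>. \<bar>W (shift_density \<rho> (real N)) \<omega> - U \<omega>\<bar> \<le> \<epsilon>"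
      using ex[OF hp hh N1] by blast
    show "\<exists>N\<ge>1. real N \<le> \<delta> * real n \<and>
      (\<forall>\<omega>. \<bar>block 1 N (\<lambda>\<omega>. real n * U \<omega>) \<omega> - real (N + n) * U \<omega>\<bar> \<le> \<delta> * real N)"
    proof (intro exI[of _ N] conjI allI N1)
      have "\<theta> * real n \<le> \<delta> * real n" using \<theta> by (intro mult_right_mono) auto
      then show N\<delta>: "real N \<le> \<delta> * real n" using N by linarith
      fix \<omega>
      have "\<bar>block 1 N (\<lambda>\<omega>. real n * U \<omega>) \<omega> - real (N + n) * U \<omega>\<bar> \<le> 2 * C * \<theta> * real N + 2 * \<epsilon> * real (N + n)"
        by (rule block_estimate_of_density[OF \<rho>(1) _ N1 \<rho>(2) h_def C N(1) \<rho>(3-5)]) (use n in auto)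
      moreover have "2 * C * \<theta> * real N \<le> \<delta> / 2 * real N" using \<theta> by (intro mult_right_mono) auto
      moreover have "2 * \<epsilon> * real (N + n) \<le> \<delta> / 2 * real N"
      proof -
        have "\<delta> * real n \<le> 1 * real n" using \<delta> by (intro mult_right_mono) auto
        then have "real (N + n) \<le> 2 * real n" using N\<delta> by simp
        then have "2 * \<epsilon> * real (N + n) \<le> 2 * \<epsilon> * (2 * real n)" using \<epsilon> by (intro mult_left_mono) auto
        also have "\<dots> = \<delta> / 4 * (\<theta> * real n)" by (simp add: \<epsilon>_def)
        also have "\<dots> \<le> \<delta> / 4 * (2 * real N)" using N2 \<delta> by (intro mult_left_mono) auto
        finally show ?thesis by simp
      qed
      ultimately show "\<bar>block 1 N (\<lambda>\<omega>. real n * U \<omega>) \<omega> - real (N + n) * U \<omega>\<bar> \<le> \<delta> * real N" by linarith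
    qed
  qed
qed

text \<open>The exponential density of rate \<open>h\<close> has height \<open>h\<close> and slope -
  h * h at 0, whence C = 1; by memorylessness its shift needs no separate estimate.\<close>

lemma uniform_limit_if_exp:
  assumes "uniform_limit UNIV (\<lambda>l. W (exp_density l)) U (at_right 0)"
  shows "uniform_limit UNIV (\<lambda>n. W (unif_density (real n))) U sequentially"
proof (rule uniform_limit_if_slow_densities[of 1])
  fix \<epsilon> :: real assume "\<epsilon> > 0"
  then have "eventually (\<lambda>l. \<forall>\<omega>\<in>UNIV. dist (W (exp_density l) \<omega>) (U \<omega>) < \<epsilon>) (at_right 0)"
    using assms by (intro uniform_limitD)
  then obtain h0 where h0: "h0 > 0" and ex: "\<And>h \<omega>. 0 < h \<Longrightarrow> h < h0 \<Longrightarrow> dist (W (exp_density h) \<omega>) (U \<omega>) < \<epsilon>"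
    by (auto simp: eventually_at_right_field)
  show "\<exists>h0>0. \<forall>h N. 0 < h \<longrightarrow> h < h0 \<longrightarrow> N \<ge> (1::nat) \<longrightarrow>
      (\<exists>\<rho>. prob_density \<rho> \<and> integral {real N..} \<rho> > 0 \<and> (\<forall>t\<ge>0. \<bar>\<rho> t - h\<bar> \<le> 1 * h * h * t) \<and>
        (\<forall>\<omega>. \<bar>W \<rho> \<omega> - U \<omega>\<bar> \<le> \<epsilon>) \<and> (\<forall>\<omega>. \<bar>W (shift_density \<rho> (real N)) \<omega> - U \<omega>\<bar> \<le> \<epsilon>))"
  proof (intro exI[of _ h0] conjI allI impI h0)
    fix h :: real and N :: nat assume h: "0 < h" "h < h0"
    have near: "\<bar>exp_density h t - h\<bar> \<le> 1 * h * h * t" if "t \<ge> 0" for t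
    proof -
      have "h * (1 - exp (- h * t)) \<le> h * (h * t)"
        using exp_ge_add_one_self[of "- h * t"] h by (intro mult_left_mono) auto
      moreover have "exp (- h * t) \<le> 1" using h that by simp
      ultimately show ?thesis using h by (simp add: exp_density_def algebra_simps)
    qed
    have close: "\<forall>\<omega>. \<bar>W (exp_density h) \<omega> - U \<omega>\<bar> \<le> \<epsilon>"
      using ex[OF h] by (simp add: dist_real_def less_imp_le)
    show "\<exists>\<rho>. prob_density \<rho> \<and> integral {real N..} \<rho> > 0 \<and> (\<forall>t\<ge>0. \<bar>\<rho> t - h\<bar> \<le> 1 * h * h * t) \<and>
        (\<forall>\<omega>. \<bar>W \<rho> \<omega> - U \<omega>\<bar> \<le> \<epsilon>) \<and> (\<forall>\<omega>. \<bar>W (shift_density \<rho> (real N)) \<omega> - U \<omega>\<bar> \<le> \<epsilon>)"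
      by (rule exI[of _ "exp_density h"])
        (use close near h in \<open>simp add: prob_density_exp shift_exp_density
          integral_unique[OF exp_density_tail_has_integral]\<close>)
  qed
qed simp

text \<open>The slow densities are the shifts of \<open>\<rho>\<close> itself: a late shift is a
  slow scaling of the profile, and the profile's slope bound at 0 becomes C = \<gamma> / (\<gamma> -
  1).\<close>

lemma uniform_limit_if_power:
  assumes \<rho>: "power_density \<rho>" and lim: "uniform_limit UNIV (\<lambda>T. W (shift_density \<rho> T)) U at_top"
  shows "uniform_limit UNIV (\<lambda>n. W (unif_density (real n))) U sequentially"
proof -
  obtain \<alpha> \<beta> \<gamma> where \<alpha>: "\<alpha> > 0" and \<beta>: "\<beta> > 0" and pd: "prob_density \<rho>"
    and eq: "\<And>t. t \<ge> 0 \<Longrightarrow> \<rho> t = (\<alpha> + \<beta> * t) powr (- \<gamma>)"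
    using \<rho> unfolding power_density_def by blast
  have \<gamma>: "\<gamma> > 1" by (rule power_density_exponent_gt_1[OF pd \<alpha> \<beta> eq])
  have shift: "shift_density \<rho> T t = scale_density (power_profile \<gamma>) (\<beta> / (\<alpha> + \<beta> * T)) t"
    if "T \<ge> 0" "t \<ge> 0" for T t
    by (rule power_density_shift(2)[OF \<alpha> \<beta> \<gamma> that(1) eq]) (use that in auto)
  note tail = prob_density_shift_power(1)[OF \<rho>]
  show ?thesis
  proof (rule uniform_limit_if_slow_densities[of "\<gamma> / (\<gamma> - 1)"])
    show "\<gamma> / (\<gamma> - 1) \<ge> 0" using \<gamma> by simp
    fix \<epsilon> :: real assume "\<epsilon> > 0"
    then have "eventually (\<lambda>T. \<forall>\<omega>\<in>UNIV. dist (W (shift_density \<rho> T) \<omega>) (U \<omega>) < \<epsilon>) at_top"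
      using lim by (intro uniform_limitD)
    then obtain T0 where T0: "\<And>T \<omega>. T \<ge> T0 \<Longrightarrow> dist (W (shift_density \<rho> T) \<omega>) (U \<omega>) < \<epsilon>"
      by (auto simp: eventually_at_top_linorder)
    \<comment> \<open>Heights below (\<gamma> - 1) / Z correspond to shifts T > \<bar>T0\<bar> +
      1.\<close>
    define Z where "Z = \<alpha> / \<beta> + \<bar>T0\<bar> + 1"
    have Z: "Z > 0" using \<alpha> \<beta> by (simp add: Z_def add_pos_nonneg)
    show "\<exists>h0>0. \<forall>h N. 0 < h \<longrightarrow> h < h0 \<longrightarrow> N \<ge> (1::nat) \<longrightarrow>
        (\<exists>\<rho>. prob_density \<rho> \<and> integral {real N..} \<rho> > 0 \<and> (\<forall>t\<ge>0. \<bar>\<rho> t - h\<bar> \<le> \<gamma> / (\<gamma> - 1) * h * h * t) \<and>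
          (\<forall>\<omega>. \<bar>W \<rho> \<omega> - U \<omega>\<bar> \<le> \<epsilon>) \<and> (\<forall>\<omega>. \<bar>W (shift_density \<rho> (real N)) \<omega> - U \<omega>\<bar> \<le> \<epsilon>))"
    proof (intro exI[of _ "(\<gamma> - 1) / Z"] conjI allI impI)
      show "(\<gamma> - 1) / Z > 0" using \<gamma> Z by simp
      fix h :: real and N :: nat assume h: "0 < h" "h < (\<gamma> - 1) / Z"
      \<comment> \<open>Solves (\<gamma> - 1) \<beta> / (\<alpha> + \<beta> T) = h, so that the
        shifted density starts at height exactly \<open>h\<close>.\<close>
      define T where "T = (\<gamma> - 1) / h - \<alpha> / \<beta>"
      have "Z < (\<gamma> - 1) / h" using h Z by (simp add: field_simps)
      then have T: "T \<ge> 0" "T \<ge> T0" by (auto simp: T_def Z_def)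
      have "\<alpha> + \<beta> * T = \<beta> * (\<gamma> - 1) / h" using \<beta> by (simp add: T_def right_diff_distrib)
      then have l: "\<beta> / (\<alpha> + \<beta> * T) = h / (\<gamma> - 1)" using \<beta> by simp
      have near: "\<bar>shift_density \<rho> T t - h\<bar> \<le> \<gamma> / (\<gamma> - 1) * h * h * t" if t: "t \<ge> 0" for t
      proof -
        define x where "x = h / (\<gamma> - 1) * t"
        have x: "x \<ge> 0" using h \<gamma> t by (simp add: x_def)
        have "shift_density \<rho> T t - h = h / (\<gamma> - 1) * (power_profile \<gamma> x - (\<gamma> - 1))"
        proof -
          have "h / q * (y - q) = h / q * y - h" if "q > 0" for q y :: real
            using that by (simp add: right_diff_distrib)
          from this[of "\<gamma> - 1"] show ?thesis
            using shift[OF T(1) t] \<gamma> by (simp add: l scale_density_def x_def)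
        qed
        then have "\<bar>shift_density \<rho> T t - h\<bar> = h / (\<gamma> - 1) * \<bar>power_profile \<gamma> x - (\<gamma> - 1)\<bar>"
          using h \<gamma> by (simp add: abs_mult)
        also have "\<dots> \<le> h / (\<gamma> - 1) * ((\<gamma> - 1) * \<gamma> * x)"
          using power_profile_near_0[OF \<gamma> x] h \<gamma> by (intro mult_left_mono) auto
        also have "\<dots> = \<gamma> / (\<gamma> - 1) * h * h * t" using \<gamma> by (simp add: x_def)
        finally show ?thesis .
      qed
      have TN: "T + real N \<ge> 0" "T + real N \<ge> T0" using T by auto
      show "\<exists>\<rho>. prob_density \<rho> \<and> integral {real N..} \<rho> > 0 \<and> (\<forall>t\<ge>0. \<bar>\<rho> t - h\<bar> \<le> \<gamma> / (\<gamma> - 1) * h * h * t) \<and>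
          (\<forall>\<omega>. \<bar>W \<rho> \<omega> - U \<omega>\<bar> \<le> \<epsilon>) \<and> (\<forall>\<omega>. \<bar>W (shift_density \<rho> (real N)) \<omega> - U \<omega>\<bar> \<le> \<epsilon>)"
      proof (intro exI[of _ "shift_density \<rho> T"] conjI allI impI near)
        show "prob_density (shift_density \<rho> T)" by (rule prob_density_shift_power(2)[OF \<rho> T(1)])
        show "integral {real N..} (shift_density \<rho> T) > 0"
          using shift_shift_density(1)[OF pd T(1) _ tail[OF T(1)], of "real N"] tail[OF T(1)] tail[OF TN(1)] by simp
        show "\<bar>W (shift_density \<rho> T) \<omega> - U \<omega>\<bar> \<le> \<epsilon>" for \<omega>
          using T0[OF T(2), of \<omega>] by (simp add: dist_real_def)
        show "\<bar>W (shift_density (shift_density \<rho> T) (real N)) \<omega> - U \<omega>\<bar> \<le> \<epsilon>" for \<omega>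
          using T0[OF TN(2), of \<omega>] shift_shift_density(2)[OF pd T(1) _ tail[OF T(1)], of "real N"]
          by (simp add: dist_real_def)
      qed
    qed
  qed
qed

section \<open>Return to suprema and the five equivalences\<close>

lemma SUP_W_iff:
  assumes "eventually (\<lambda>x. prob_density (\<rho> x)) F"
  shows "((\<lambda>x. SUP \<omega>. \<bar>W (\<rho> x) \<omega> - U \<omega>\<bar>) \<longlongrightarrow> 0) F \<longleftrightarrow> uniform_limit UNIV (\<lambda>x. W (\<rho> x)) U F"
proof (rule SUP_tendsto_0_iff_uniform_limit)
  show "eventually (\<lambda>x. bounded (range (\<lambda>\<omega>. W (\<rho> x) \<omega> - U \<omega>))) F"
    using assms
  proof eventually_elim
    case (elim x)
    have "bounded (range (\<lambda>\<omega>. W (\<rho> x) \<omega> - 1 * U \<omega>))"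
      by (rule bounded_minus_comp[OF bounded_W[OF prob_density_absolutely_integrable[OF elim]] bounded_U])
    then show ?case by simp
  qed
qed

end

text \<open>All conditions follow from (u') through \<open>scale_limit\<close>. Back to (u'), (c)
  passes through (e), (u) is restricted to integer horizons, and (q) passes through (p).\<close>

theorem theorem2:
  fixes K :: "(real \<Rightarrow> 'w) set"
    and g :: "'w \<Rightarrow> real"
    and V :: "((real \<Rightarrow> 'w) \<Rightarrow> real) \<Rightarrow> 'w \<Rightarrow> real"
    and U :: "'w \<Rightarrow> real"
  assumes K_ne: "K \<noteq> {}"
    and g_range: "\<And>\<omega>. 0 \<le> g \<omega> \<and> g \<omega> \<le> 1"
    and g_meas: "\<And>z. z \<in> K \<Longrightarrow> set_borel_measurable lebesgue {0..} (\<lambda>t. g (z t))"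
    and game: "game_mapping K V"
    and dpp: "discrete_DPP g V"
    and U_range: "\<And>\<omega>. 0 \<le> U \<omega> \<and> U \<omega> \<le> 1"
    and step: "\<And>z (n::nat) s. z \<in> K \<Longrightarrow> 0 < s \<Longrightarrow> s < 1 \<Longrightarrow> z (real n + s) = z (real n)"
  defines "u' \<equiv> ((\<lambda>n::nat. SUP \<omega>. \<bar>Val g V (unif_density (real n)) \<omega> - U \<omega>\<bar>) \<longlonglongrightarrow> 0)"
  shows
    "((\<forall>\<mu>. prob_density \<mu> \<and> piecewise_continuous_pos \<mu> \<longrightarrow>
         ((\<lambda>l. SUP \<omega>. \<bar>Val g V (scale_density \<mu> l) \<omega> - U \<omega>\<bar>) \<longlongrightarrow> 0) (at_right 0))
       \<longleftrightarrow> u')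
   \<and> ((((\<lambda>T. SUP \<omega>. \<bar>Val g V (unif_density T) \<omega> - U \<omega>\<bar>) \<longlongrightarrow> 0) at_top) \<longleftrightarrow> u')
   \<and> ((((\<lambda>l. SUP \<omega>. \<bar>Val g V (exp_density l) \<omega> - U \<omega>\<bar>) \<longlongrightarrow> 0) (at_right 0)) \<longleftrightarrow> u')
   \<and> ((\<exists>\<rho>. power_density \<rho> \<and>
         ((\<lambda>T. SUP \<omega>. \<bar>Val g V (shift_density \<rho> T) \<omega> - U \<omega>\<bar>) \<longlongrightarrow> 0) at_top) \<longleftrightarrow> u')
   \<and> ((\<forall>\<rho>. power_density \<rho> \<longrightarrow>
         ((\<lambda>T. SUP \<omega>. \<bar>Val g V (shift_density \<rho> T) \<omega> - U \<omega>\<bar>) \<longlongrightarrow> 0) at_top) \<longleftrightarrow> u')"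
proof -
  interpret tauberian_game_limit K g V U
    by unfold_locales (use assms in auto)
  let ?lim = "uniform_limit UNIV (\<lambda>n. W (unif_density (real n))) U sequentially"
  have u': "u' \<longleftrightarrow> ?lim"
    unfolding u'_def
  proof (rule SUP_W_iff)
    show "\<forall>\<^sub>F n in sequentially. prob_density (unif_density (real n))"
      using eventually_gt_at_top[of 0] by eventually_elim (simp add: prob_density_unif)
  qed
  have c: "((\<lambda>l. SUP \<omega>. \<bar>W (scale_density \<mu> l) \<omega> - U \<omega>\<bar>) \<longlongrightarrow> 0) (at_right 0)
      \<longleftrightarrow> uniform_limit UNIV (\<lambda>l. W (scale_density \<mu> l)) U (at_right 0)" if "prob_density \<mu>" for \<mu>
  proof (rule SUP_W_iff)
    show "\<forall>\<^sub>F l in at_right 0. prob_density (scale_density \<mu> l)"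
      using eventually_at_right_less[of 0] by eventually_elim (rule prob_density_scale[OF that])
  qed
  have u: "((\<lambda>T. SUP \<omega>. \<bar>W (unif_density T) \<omega> - U \<omega>\<bar>) \<longlongrightarrow> 0) at_top
      \<longleftrightarrow> uniform_limit UNIV (\<lambda>T. W (unif_density T)) U at_top"
  proof (rule SUP_W_iff)
    show "\<forall>\<^sub>F T in at_top. prob_density (unif_density T)"
      using eventually_gt_at_top[of 0] by eventually_elim (rule prob_density_unif)
  qed
  have e: "((\<lambda>l. SUP \<omega>. \<bar>W (exp_density l) \<omega> - U \<omega>\<bar>) \<longlongrightarrow> 0) (at_right 0)
      \<longleftrightarrow> uniform_limit UNIV (\<lambda>l. W (exp_density l)) U (at_right 0)"
  proof (rule SUP_W_iff)
    show "\<forall>\<^sub>F l in at_right 0. prob_density (exp_density l)"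
      using eventually_at_right_less[of 0] by eventually_elim (rule prob_density_exp)
  qed
  have p: "((\<lambda>T. SUP \<omega>. \<bar>W (shift_density \<rho> T) \<omega> - U \<omega>\<bar>) \<longlongrightarrow> 0) at_top
      \<longleftrightarrow> uniform_limit UNIV (\<lambda>T. W (shift_density \<rho> T)) U at_top" if \<rho>: "power_density \<rho>" for \<rho>
  proof (rule SUP_W_iff)
    show "\<forall>\<^sub>F T in at_top. prob_density (shift_density \<rho> T)"
      using eventually_ge_at_top[of 0]
      by eventually_elim (rule prob_density_shift_power(2)[OF \<rho>])
  qed
  have u_lim: "?lim" if "uniform_limit UNIV (\<lambda>T. W (unif_density T)) U at_top"
    by (rule filterlim_compose[OF that filterlim_real_sequentially])
  have c_lim: "?lim" if "\<forall>\<mu>. prob_density \<mu> \<and> piecewise_continuous_pos \<mu> \<longrightarrow>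
      uniform_limit UNIV (\<lambda>l. W (scale_density \<mu> l)) U (at_right 0)"
  proof (rule uniform_limit_if_exp)
    show "uniform_limit UNIV (\<lambda>l. W (exp_density l)) U (at_right 0)"
      using that[rule_format, of "exp_density 1"] prob_density_exp[of 1] piecewise_continuous_exp_density
      by (simp add: scale_exp_density)
  qed
  show ?thesis
    unfolding u' u e
  proof (intro conjI)
    show "(\<forall>\<mu>. prob_density \<mu> \<and> piecewise_continuous_pos \<mu> \<longrightarrow>
         ((\<lambda>l. SUP \<omega>. \<bar>W (scale_density \<mu> l) \<omega> - U \<omega>\<bar>) \<longlongrightarrow> 0) (at_right 0)) \<longleftrightarrow> ?lim"
      using c c_lim scale_limit by blast
    show "uniform_limit UNIV (\<lambda>T. W (unif_density T)) U at_top \<longleftrightarrow> ?lim"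
      using u_lim unif_limit by blast
    show "uniform_limit UNIV (\<lambda>l. W (exp_density l)) U (at_right 0) \<longleftrightarrow> ?lim"
      using uniform_limit_if_exp exp_limit by blast
    show "(\<exists>\<rho>. power_density \<rho> \<and>
         ((\<lambda>T. SUP \<omega>. \<bar>W (shift_density \<rho> T) \<omega> - U \<omega>\<bar>) \<longlongrightarrow> 0) at_top) \<longleftrightarrow> ?lim"
      using p uniform_limit_if_power power_limit power_density_exists by blast
    show "(\<forall>\<rho>. power_density \<rho> \<longrightarrow>
         ((\<lambda>T. SUP \<omega>. \<bar>W (shift_density \<rho> T) \<omega> - U \<omega>\<bar>) \<longlongrightarrow> 0) at_top) \<longleftrightarrow> ?lim"
      using p uniform_limit_if_power power_limit power_density_exists by blast
  qed
qed

end
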